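(* Let $P\subset\mathbb{R}^d$ be a $d$-polytope with vertices $v_1,\dots,v_n$, and let $py(P,v)\subset\mathbb{R}^{d+1}$ be the pyramid, i.e. the convex hull of $P\times\{0\}$ and a point $v\in\mathbb{R}^{d+1}$ not in the hyperplane $\mathbb{R}^d\times\{0\}$. For a polytopal digraph $G(P)$, let $py(G(P),v)$ be the polytopal digraph of $py(P,v)$ that keeps the orientation of every edge of $G(P)$ and directs every new edge as $(v_i,v)$, i.e. from $v_i$ to $v$, for $i=1,\dots,n$. If $G(P)$ is an $X$-type graph, then $py(G(P),v)$ is also an $X$-type graph.
   Context: A polytopal digraph $G(P)$ is an orientation of the edges of the skeleton of $P$; for a face $H$, $G(P,H)$ is the induced subdigraph on the vertices of $H$. Acyclic: no directed cycle. USO: for every non-empty face $H$, $G(P,H)$ has a unique source and a unique sink. Holt–Klee property: USO and for every $k$-face $H$ there are $k$ vertex-disjoint (apart from endpoints) directed paths in $G(P,H)$ from its source to its sink. A topological sort is a vertex ordering in which $u$ precedes $w$ whenever $(u,w)$ is an edge. $P^*$ is a combinatorial polar of $P$ (face lattice turned upside down), $F(w)$ the facet of $P^*$ corresponding to vertex $w$. A shelling of a polytope $Q$ is a linear ordering $F_1,\dots,F_s$ of its facets such that either the facets are points, or (i) $F_1$ has a linear ordering of its own facets that is a shelling of $F_1$, and (ii) for $1<j\le s$, $F_j\cap\bigcup_{i<j}F_i$ is non-empty and equals $G_1\cup\cdots\cup G_r$ for some shelling $G_1,\dots,G_r,\dots,G_t$ of $F_j$, $1\le r\le t$. Shelling property: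 some topological sort $w_1,\dots,w_n$ of $G(P)$ makes $F(w_1),\dots,F(w_n)$ a shelling of $P^*$. $X$-type graph: an acyclic USO with the Holt–Klee property but without the shelling property. *)

theory Defs
  imports "HOL-Analysis.Analysis"
begin

section \<open>Polytopal digraphs\<close>

definition vertices_of :: "'a::euclidean_space set \<Rightarrow> 'a set" where
  "vertices_of P = {x. x extreme_point_of P}"

text \<open>
  A polytopal digraph \<open>G(P)\<close> is given by the polytope \<open>P\<close> and the set \<open>E\<close> of its directed edges.
\<close>

definition polytopal_digraph :: "'a::euclidean_space set \<Rightarrow> ('a \<times> 'a) set \<Rightarrow> bool" where
  "polytopal_digraph P E \<longleftrightarrow>
     polytope P \<and>
     (\<forall>u w. (u, w) \<in> E \<longrightarrow> closed_segment u w edge_of P) \<and>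
     (\<forall>u w. closed_segment u w edge_of P \<longrightarrow> ((u, w) \<in> E) \<noteq> ((w, u) \<in> E))"

definition induced_digraph :: "('a::euclidean_space \<times> 'a) set \<Rightarrow> 'a set \<Rightarrow> ('a \<times> 'a) set" where
  "induced_digraph E H = E \<inter> (vertices_of H \<times> vertices_of H)"

definition source_in :: "('a::euclidean_space \<times> 'a) set \<Rightarrow> 'a set \<Rightarrow> 'a \<Rightarrow> bool" where
  "source_in E H s \<longleftrightarrow> s \<in> vertices_of H \<and> (\<forall>u. (u, s) \<notin> induced_digraph E H)"

definition sink_in :: "('a::euclidean_space \<times> 'a) set \<Rightarrow> 'a set \<Rightarrow> 'a \<Rightarrow> bool" where
  "sink_in E H t \<longleftrightarrow> t \<in> vertices_of H \<and> (\<forall>u. (t, u) \<notin> induced_digraph E H)"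

definition unique_sink_orientation :: "'a::euclidean_space set \<Rightarrow> ('a \<times> 'a) set \<Rightarrow> bool" where
  "unique_sink_orientation P E \<longleftrightarrow>
     (\<forall>H. H face_of P \<and> H \<noteq> {} \<longrightarrow> (\<exists>!s. source_in E H s) \<and> (\<exists>!t. sink_in E H t))"

text \<open>Directed paths, as lists of distinct vertices.\<close>

definition dipath :: "('a \<times> 'a) set \<Rightarrow> 'a \<Rightarrow> 'a list \<Rightarrow> 'a \<Rightarrow> bool" where
  "dipath A s p t \<longleftrightarrow>
     p \<noteq> [] \<and> hd p = s \<and> last p = t \<and> distinct p \<and> successively (\<lambda>u w. (u, w) \<in> A) p"

text \<open>
  The paths form a set of size \<open>k\<close>, so they are distinct; in particular the path consisting of a
  single edge from \<open>s\<close> to \<open>t\<close>, which has no inner vertices, counts at most once.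
\<close>

definition holt_klee :: "'a::euclidean_space set \<Rightarrow> ('a \<times> 'a) set \<Rightarrow> bool" where
  "holt_klee P E \<longleftrightarrow>
     unique_sink_orientation P E \<and>
     (\<forall>H s t. H face_of P \<and> H \<noteq> {} \<and> source_in E H s \<and> sink_in E H t \<longrightarrow>
        (\<exists>Ps. finite Ps \<and> int (card Ps) = aff_dim H \<and>
              (\<forall>p\<in>Ps. dipath (induced_digraph E H) s p t) \<and>
              (\<forall>p\<in>Ps. \<forall>q\<in>Ps. p \<noteq> q \<longrightarrow> set p \<inter> set q \<subseteq> {s, t})))"

definition topological_sort :: "'a::euclidean_space set \<Rightarrow> ('a \<times> 'a) set \<Rightarrow> 'a list \<Rightarrow> bool" where
  "topological_sort P E ws \<longleftrightarrow>
     distinct ws \<and> set ws = vertices_of P \<and>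
     (\<forall>i<length ws. \<forall>j<length ws. (ws ! i, ws ! j) \<in> E \<longrightarrow> i < j)"

section \<open>Polars and shellings\<close>

text \<open>
  \<open>Q\<close> is a combinatorial polar of \<open>P\<close>, witnessed by the order-reversing bijection \<open>\<phi>\<close> between the
  face lattices (both include the empty face and the polytope itself). The facet \<open>F(w)\<close> of \<open>Q\<close>
  that corresponds to the vertex \<open>w\<close> of \<open>P\<close> is \<open>\<phi> {w}\<close>.
\<close>

definition combinatorial_polar ::
  "'a::euclidean_space set \<Rightarrow> 'a set \<Rightarrow> ('a set \<Rightarrow> 'a set) \<Rightarrow> bool" where
  "combinatorial_polar P Q \<phi> \<longleftrightarrow>
     polytope Q \<and>
     bij_betw \<phi> {F. F face_of P} {F. F face_of Q} \<and>
     (\<forall>F G. F face_of P \<and> G face_of P \<longrightarrow> (F \<subseteq> G \<longleftrightarrow> \<phi> G \<subseteq> \<phi> F))"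

text \<open>
  The recursion is on the dimension. List positions start at \<open>0\<close>, so \<open>F\<^sub>1\<close> is \<open>hd Fs\<close> and the
  condition on \<open>F\<^sub>j\<close> for \<open>1 < j \<le> s\<close> is stated for \<open>Fs ! j\<close> with \<open>1 \<le> j < length Fs\<close>.
\<close>

inductive shelling :: "'a::euclidean_space set \<Rightarrow> 'a set list \<Rightarrow> bool" where
  points:
    "distinct Fs \<Longrightarrow> set Fs = {F. F facet_of Q} \<Longrightarrow>
     (\<forall>F\<in>set Fs. \<exists>x. F = {x}) \<Longrightarrow>
     shelling Q Fs"
| step:
    "distinct Fs \<Longrightarrow> set Fs = {F. F facet_of Q} \<Longrightarrow> Fs \<noteq> [] \<Longrightarrow>
     (\<exists>Gs. shelling (hd Fs) Gs) \<Longrightarrow>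
     (\<forall>j. 1 \<le> j \<and> j < length Fs \<longrightarrow>
        Fs ! j \<inter> (\<Union>i<j. Fs ! i) \<noteq> {} \<and>
        (\<exists>Gs r. shelling (Fs ! j) Gs \<and> 1 \<le> r \<and> r \<le> length Gs \<and>
                Fs ! j \<inter> (\<Union>i<j. Fs ! i) = \<Union>(set (take r Gs)))) \<Longrightarrow>
     shelling Q Fs"

text \<open>
  Every polytope has a combinatorial polar of the same dimension, hence one in the same space, and
  whether a sequence of facets is a shelling depends on the face lattice only. So it does not matter
  which polar is taken.
\<close>

definition shelling_property :: "'a::euclidean_space set \<Rightarrow> ('a \<times> 'a) set \<Rightarrow> bool" where
  "shelling_property P E \<longleftrightarrow>
     (\<exists>ws Q \<phi>. topological_sort P E ws \<and> combinatorial_polar P Q \<phi> \<and>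
               shelling Q (map (\<lambda>w. \<phi> {w}) ws))"

definition X_type :: "'a::euclidean_space set \<Rightarrow> ('a \<times> 'a) set \<Rightarrow> bool" where
  "X_type P E \<longleftrightarrow>
     polytopal_digraph P E \<and> acyclic E \<and> unique_sink_orientation P E \<and> holt_klee P E \<and>
     \<not> shelling_property P E"

section \<open>Pyramids\<close>

definition py :: "'a::euclidean_space set \<Rightarrow> 'a \<times> real \<Rightarrow> ('a \<times> real) set" where
  "py P v = convex hull (insert v (P \<times> {0}))"

definition py_digraph ::
  "'a::euclidean_space set \<Rightarrow> ('a \<times> 'a) set \<Rightarrow> 'a \<times> real \<Rightarrow> (('a \<times> real) \<times> ('a \<times> real)) set" where
  "py_digraph P E v =
     {((u, 0), (w, 0)) | u w. (u, w) \<in> E} \<union> {((u, 0), v) | u. u \<in> vertices_of P}"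

end

theory Submission
  imports Defs
begin

text \<open>
  The faces of the pyramid are the faces of the base and the pyramids over them. A pyramid over a
  non-empty face has the source of that face and the sink \<open>v\<close>; of the disjoint paths from source to
  sink in the base, one is prolonged to \<open>v\<close>, the others are cut off before the sink and diverted to
  \<open>v\<close>, and the edge from the source to \<open>v\<close> is the additional path.

  For the shelling property, the polar \<open>Q\<close> of a pyramid is itself a pyramid, over its facet \<open>F(v)\<close>,
  and this facet is a polar of \<open>P\<close>. Intersecting the facets of a shelling of a pyramid with the base
  gives, after removal of the base itself, a shelling of the base; the proof is by induction on the
  dimension. Since \<open>v\<close> comes last in every topological sort, a shelling of \<open>Q\<close> induced by a topological
  sort of the pyramid thus restricts to a shelling of \<open>F(v)\<close> induced by one of \<open>P\<close>.
\<close>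

section \<open>Faces of pyramids\<close>

text \<open>\<open>combinatorial_polar\<close> keeps a polytope and its polar in one type. The polar
  of the pyramid lives in \<open>'a \<times> real\<close>, whereas a polar of \<open>P\<close> has
  to live in \<open>'a\<close>; the facet F(v) must therefore be moved into a smaller space, which
  is why affine embeddings enter. About the polar only its face lattice is known. That it is a
  pyramid comes from the fact that the base is the only facet of a pyramid that misses the apex, so
  that dually all vertices of the polar but one lie on F(v). A shelling, on the other hand, speaks
  of unions of point sets. Restricting it to the base thus needs geometry: an equation between
  unions of faces has to be carried over to their traces on the base, although some of these faces
  may be bases themselves and have to be discarded.\<close>

definition pyramid :: "'a::euclidean_space \<Rightarrow> 'a set \<Rightarrow> 'a set" where
  "pyramid a B = convex hull (insert a B)"

lemma subset_pyramid: "B \<subseteq> pyramid a B"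
  unfolding pyramid_def by (meson hull_subset subset_insertI subset_trans)

lemma apex_in_pyramid [simp]: "a \<in> pyramid a B"
  unfolding pyramid_def by (simp add: hull_inc)

text \<open>The apex counts as the pyramid over the empty face. Faces through the apex thus
  correspond to all faces of the base, and \<open>{a}\<close> needs no separate treatment.\<close>

lemma pyramid_empty [simp]: "pyramid a {} = {a}"
  by (simp add: pyramid_def)

lemma pyramid_mono: "F \<subseteq> G \<Longrightarrow> pyramid a F \<subseteq> pyramid a G"
  unfolding pyramid_def by (intro hull_mono insert_mono)

text \<open>The alternative \<open>x = a\<close> is there for the empty base, where no
  \<open>b\<close> exists.\<close>

lemma pyramid_cases:
  assumes "x \<in> pyramid a B" "convex B"
  obtains "x = a" | u b where "0 \<le> u" "u \<le> 1" "b \<in> B" "x = u *\<^sub>R a + (1 - u) *\<^sub>R b"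
proof (cases "B = {}")
  case False
  then obtain u v b where "u \<ge> 0" "v \<ge> 0" "u + v = 1" "b \<in> B" "x = u *\<^sub>R a + v *\<^sub>R b"
    using assms by (auto simp: pyramid_def convex_hull_insert hull_same)
  moreover from this have "v = 1 - u" by simp
  ultimately show ?thesis
    by (intro that(2)[of u b]) auto
qed (use assms that in auto)

lemma polytope_pyramid:
  assumes "polytope B"
  shows "polytope (pyramid a B)"
proof -
  obtain S where "finite S" "B = convex hull S"
    using assms by (auto simp: polytope_def)
  then have "pyramid a B = convex hull (insert a S)"
    by (simp add: pyramid_def hull_insert[symmetric])
  with \<open>finite S\<close> show ?thesis
    by (simp add: polytope_convex_hull)
qed

lemma face_of_pyramid_iff:
  assumes "polytope B" "a \<notin> affine hull B"
  shows "F face_of pyramid a B \<longleftrightarrow> F face_of B \<or> (\<exists>G. G face_of B \<and> F = pyramid a G)"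
proof -
  obtain S where S: "finite S" "B = convex hull S"
    using assms by (auto simp: polytope_def)
  have "pyramid a B = convex hull (insert a S)"
    using S by (simp add: pyramid_def hull_insert[symmetric])
  moreover have "a \<notin> affine hull S"
    using assms S by (simp add: affine_hull_convex_hull)
  ultimately show ?thesis
    using face_of_convex_hull_insert_eq[OF S(1)] S(2) by (simp add: pyramid_def)
qed

lemma pyramid_Int_base:
  assumes "convex G" "G \<subseteq> B" "a \<notin> affine hull B"
  shows "pyramid a G \<inter> B = G"
proof
  show "pyramid a G \<inter> B \<subseteq> G"
  proof
    fix x assume x: "x \<in> pyramid a G \<inter> B"
    then have xB: "x \<in> affine hull B" by (simp add: hull_inc)
    from x have "x \<in> pyramid a G" by simp
    from this assms(1) show "x \<in> G"
    proof (cases rule: pyramid_cases)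
      case 1 then show ?thesis using xB assms by simp
    next
      case (2 u b)
      show ?thesis
      proof (cases "u = 0")
        case False
        \<comment> \<open>The equation \<open>2(4)\<close> is solved for \<open>a\<close>: if
          \<open>u\<close> were not 0, the apex would be an affine combination of the base points
          \<open>x\<close> and \<open>b\<close>.\<close>
        have "(1 / u) *\<^sub>R x + (1 - 1 / u) *\<^sub>R b = a + ((1 - u) / u + (1 - 1 / u)) *\<^sub>R b"
          using False unfolding 2(4) by (simp only: scaleR_add_right scaleR_add_left scaleR_scaleR) simp
        also have "(1 - u) / u + (1 - 1 / u) = 0" using False by (simp add: field_simps)
        finally have "a = (1 / u) *\<^sub>R x + (1 - 1 / u) *\<^sub>R b" by simp
        moreover have "b \<in> affine hull B" using 2 assms by (meson hull_inc subsetD)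
        ultimately have "a \<in> affine hull B"
          using mem_affine[OF affine_affine_hull xB, of b "1/u" "1 - 1/u"] by simp
        with assms show ?thesis by simp
      qed (use 2 in simp)
    qed
  qed
qed (use assms subset_pyramid in blast)

lemma apex_notin_base: "a \<notin> affine hull B \<Longrightarrow> a \<notin> B"
  by (meson hull_inc)

lemma apex_notin_affine_hull_mono: "a \<notin> affine hull B \<Longrightarrow> G \<subseteq> B \<Longrightarrow> a \<notin> affine hull G"
  by (meson hull_mono subsetD)

lemma aff_dim_pyramid:
  assumes "a \<notin> affine hull B"
  shows "aff_dim (pyramid a B) = aff_dim B + 1"
  using assms by (simp add: pyramid_def aff_dim_convex_hull aff_dim_insert)

lemma midpoint_in_pyramid:
  assumes "b \<in> G"
  shows "midpoint a b \<in> pyramid a G"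
proof -
  have "midpoint a b \<in> closed_segment a b" by simp
  also have "\<dots> \<subseteq> pyramid a G"
    using assms by (auto simp: pyramid_def segment_convex_hull intro!: hull_mono)
  finally show ?thesis .
qed

text \<open>Central projection from the apex sends the midpoint back to \<open>b\<close>, and it
  maps the rest of the pyramid into \<open>G\<close>. Half height is an arbitrary choice; it only
  has to be neither the apex nor the base.\<close>

lemma midpoint_in_pyramidD:
  assumes m: "midpoint a b \<in> pyramid a G" and G: "convex G" "G \<subseteq> B" and b: "b \<in> B" and a: "a \<notin> affine hull B"
  shows "b \<in> G"
  using m G(1)
proof (cases rule: pyramid_cases)
  case 1
  then show ?thesis using a b by (metis hull_inc midpoint_eq_endpoint(1))
next
  case (2 u g)
  \<comment> \<open>The coefficient that \<open>a\<close> retains when the two representations of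
    the doubled midpoint are compared. If it vanishes, the base points \<open>b\<close> and
    \<open>g\<close> agree; otherwise \<open>a\<close> is an affine combination of them.\<close>
  define s where "s = 1 - 2 * u"
  have "2 *\<^sub>R midpoint a b = a + b" by (simp add: midpoint_def)
  then have "a + b = 2 *\<^sub>R (u *\<^sub>R a + (1 - u) *\<^sub>R g)" using 2 by simp
  then have *: "s *\<^sub>R a = (1 + s) *\<^sub>R g - b" by (simp add: s_def algebra_simps)
  show ?thesis
  proof (cases "s = 0")
    case True
    with * show ?thesis using 2 by simp
  next
    case False
    have "a = (1 / s) *\<^sub>R (s *\<^sub>R a)" using False by simp
    also have "\<dots> = ((1 + s) / s) *\<^sub>R g + (- 1 / s) *\<^sub>R b"
      unfolding * by (simp add: scaleR_diff_right)
    also have "\<dots> \<in> affine hull B"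
      using False 2 G b by (intro mem_affine affine_affine_hull) (auto simp: hull_inc subsetD divide_simps)
    finally show ?thesis using a by simp
  qed
qed

lemma midpoint_apex_notin_base:
  assumes "b \<in> B" "a \<notin> affine hull B"
  shows "midpoint a b \<notin> B"
proof
  assume "midpoint a b \<in> B"
  then have "2 *\<^sub>R midpoint a b + (-1) *\<^sub>R b \<in> affine hull B"
    using assms by (intro mem_affine affine_affine_hull) (auto simp: hull_inc)
  moreover have "2 *\<^sub>R midpoint a b + (-1) *\<^sub>R b = a" by (simp add: midpoint_def)
  ultimately show False using assms by simp
qed

text \<open>Dimension decides which faces are facets. The bound on \<open>aff_dim B\<close> excludes
  the segment over a point: there \<open>{a}\<close> is a facet, but it is the pyramid over the
  empty face, which does not count as a facet of the point.\<close>

lemma facet_of_pyramid_iff: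
  assumes B: "polytope B" and a: "a \<notin> affine hull B" and dim: "1 \<le> aff_dim B"
  shows "F facet_of pyramid a B \<longleftrightarrow> F = B \<or> (\<exists>G. G facet_of B \<and> F = pyramid a G)"
proof
  assume F: "F facet_of pyramid a B"
  then have dF: "aff_dim F = aff_dim B" by (simp add: facet_of_def aff_dim_pyramid a)
  from F have "F face_of B \<or> (\<exists>G. G face_of B \<and> F = pyramid a G)"
    by (simp add: facet_of_def face_of_pyramid_iff[OF B a])
  then show "F = B \<or> (\<exists>G. G facet_of B \<and> F = pyramid a G)"
  proof
    assume "F face_of B"
    then show ?thesis
      using dF face_of_aff_dim_lt[of B F] B by (auto simp: polytope_imp_convex)
  next
    assume "\<exists>G. G face_of B \<and> F = pyramid a G"
    then obtain G where G: "G face_of B" "F = pyramid a G" by blast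
    then have "aff_dim F = aff_dim G + 1"
      by (metis a aff_dim_pyramid apex_notin_affine_hull_mono face_of_imp_subset)
    then have "G facet_of B"
      using G dF dim by (auto simp: facet_of_def)
    with G show ?thesis by blast
  qed
next
  assume "F = B \<or> (\<exists>G. G facet_of B \<and> F = pyramid a G)"
  then show "F facet_of pyramid a B"
  proof
    assume "F = B"
    then show ?thesis
      using B a dim by (auto simp: facet_of_def face_of_pyramid_iff aff_dim_pyramid face_of_refl polytope_imp_convex)
  next
    assume "\<exists>G. G facet_of B \<and> F = pyramid a G"
    then obtain G where G: "G face_of B" "G \<noteq> {}" "aff_dim G = aff_dim B - 1" "F = pyramid a G"
      by (auto simp: facet_of_def)
    then have "a \<notin> affine hull G"
      using a apex_notin_affine_hull_mono face_of_imp_subset by blast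
    then show ?thesis
      using G B a subset_pyramid[of G a]
      by (auto simp: facet_of_def face_of_pyramid_iff[OF B a] aff_dim_pyramid)
  qed
qed

lemma face_of_pyramid_mono_iff:
  assumes "polytope B" "a \<notin> affine hull B" "F face_of B" "G face_of B"
  shows "pyramid a F \<subseteq> pyramid a G \<longleftrightarrow> F \<subseteq> G"
proof -
  have eq: "pyramid a H \<inter> B = H" if "H face_of B" for H
    using pyramid_Int_base[OF face_of_imp_convex[OF that] face_of_imp_subset[OF that] assms(2)] .
  show ?thesis
  proof
    assume "pyramid a F \<subseteq> pyramid a G"
    then have "pyramid a F \<inter> B \<subseteq> pyramid a G \<inter> B" by (rule Int_mono) simp
    then show "F \<subseteq> G" by (simp only: eq assms)
  qed (rule pyramid_mono)
qed

lemma vertices_of_iff: "x \<in> vertices_of P \<longleftrightarrow> {x} face_of P"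
  by (simp add: vertices_of_def face_of_singleton)

lemma polytope_vertex_exists:
  assumes "polytope B" "B \<noteq> {}"
  obtains w where "w \<in> vertices_of B"
proof -
  obtain w where "w extreme_point_of B"
    using extreme_point_exists_convex[OF polytope_imp_compact polytope_imp_convex, OF assms(1) assms(1) assms(2)] by metis
  then show ?thesis using that by (simp add: vertices_of_def)
qed

lemma vertices_of_pyramid:
  assumes "polytope B" "a \<notin> affine hull B"
  shows "vertices_of (pyramid a B) = insert a (vertices_of B)"
proof (intro equalityI subsetI)
  fix x assume "x \<in> vertices_of (pyramid a B)"
  then consider "{x} face_of B" | G where "{x} = pyramid a G"
    unfolding vertices_of_iff face_of_pyramid_iff[OF assms] by blast
  then show "x \<in> insert a (vertices_of B)"
  proof cases
    case (2 G)
    then have "a \<in> {x}" using apex_in_pyramid[of a G] by (simp only:)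
    then show ?thesis by simp
  qed (simp add: vertices_of_iff)
next
  fix x assume "x \<in> insert a (vertices_of B)"
  then show "x \<in> vertices_of (pyramid a B)"
    unfolding vertices_of_iff face_of_pyramid_iff[OF assms]
    using pyramid_empty[of a] empty_face_of[of B] by (metis insertE vertices_of_iff)
qed

lemma vertices_of_subset: "vertices_of P \<subseteq> P"
  by (auto simp: vertices_of_def extreme_point_of_def)

lemma vertices_of_face: "F face_of P \<Longrightarrow> vertices_of F = vertices_of P \<inter> F"
  using face_of_face[of F P] by (auto simp: vertices_of_iff)

section \<open>Shellings of pyramids\<close>

lemma facet_points_of_segment:
  fixes B :: "'a::euclidean_space set"
  assumes "aff_dim B = 1" "F facet_of B"
  shows "\<exists>x. F = {x}"
  using assms by (simp add: facet_of_def aff_dim_eq_0)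

text \<open>Traces an entry that survives the deletion of the base facet to its place in the
  original sequence. The equation between prefixes lets the union of the earlier survivors be
  compared with the union of all earlier facets.\<close>

lemma filter_nthE:
  assumes "j < length (filter P xs)"
  obtains i where "i < length xs" "filter P xs ! j = xs ! i" "P (xs ! i)"
    "take j (filter P xs) = filter P (take i xs)"
proof -
  have "\<exists>i<length xs. filter P xs ! j = xs ! i \<and> P (xs ! i) \<and> take j (filter P xs) = filter P (take i xs)"
    using assms
  proof (induction xs arbitrary: j)
    case (Cons x xs)
    show ?case
    proof (cases "P x \<and> j = 0")
      case True
      then show ?thesis by (intro exI[of _ 0]) auto
    next
      case False
      define k where "k = (if P x then j - 1 else j)"
      have "k < length (filter P xs)" using Cons.prems False by (auto simp: k_def split: if_splits)
      then obtain i where i: "i < length xs" "filter P xs ! k = xs ! i" "P (xs ! i)"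
        "take k (filter P xs) = filter P (take i xs)" using Cons.IH by blast
      then show ?thesis
        using False by (intro exI[of _ "Suc i"]) (auto simp: k_def nth_Cons' take_Cons' split: if_splits)
    qed
  qed simp
  then show ?thesis using that by blast
qed

lemma UN_nth_eq_take:
  "j \<le> length xs \<Longrightarrow> (\<Union>i<j. xs ! i) = \<Union> (set (take j xs))"
  by (simp add: nth_image[symmetric] lessThan_atLeast0)

lemma shelling_facets: "shelling Q Fs \<Longrightarrow> distinct Fs \<and> set Fs = {F. F facet_of Q}"
  by (erule shelling.cases) auto

lemma facets_of_base:
  assumes B: "polytope B" and a: "a \<notin> affine hull B" and dim: "1 \<le> aff_dim B"
    and Fs: "distinct Fs" "set Fs = {F. F facet_of pyramid a B}"
  shows "distinct (map (\<lambda>F. F \<inter> B) (filter (\<lambda>F. F \<noteq> B) Fs))"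
    and "set (map (\<lambda>F. F \<inter> B) (filter (\<lambda>F. F \<noteq> B) Fs)) = {F. F facet_of B}"
proof -
  have base: "pyramid a G \<inter> B = G" if "G facet_of B" for G
    using that B a by (intro pyramid_Int_base) (auto simp: facet_of_imp_subset facet_of_def face_of_imp_convex)
  \<comment> \<open>\<open>B\<close> is not a pyramid with apex \<open>a\<close>, because it does
    not contain \<open>a\<close>; so deleting it leaves precisely the pyramids over facets of
    \<open>B\<close>.\<close>
  have set: "set (filter (\<lambda>F. F \<noteq> B) Fs) = pyramid a ` {G. G facet_of B}"
    using Fs(2) apex_notin_base[OF a] apex_in_pyramid[of a]
    by (auto simp: facet_of_pyramid_iff[OF B a dim])
  have "inj_on (\<lambda>F. F \<inter> B) (pyramid a ` {G. G facet_of B})"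
    by (rule inj_onI) (metis (no_types, lifting) base imageE mem_Collect_eq)
  then show "distinct (map (\<lambda>F. F \<inter> B) (filter (\<lambda>F. F \<noteq> B) Fs))"
    unfolding distinct_map set using Fs(1) by (simp only: distinct_filter)
  have "(\<lambda>F. F \<inter> B) ` pyramid a ` {G. G facet_of B} = (\<lambda>G. G) ` {G. G facet_of B}"
    unfolding image_image by (rule image_cong) (simp_all add: base)
  then show "set (map (\<lambda>F. F \<inter> B) (filter (\<lambda>F. F \<noteq> B) Fs)) = {F. F facet_of B}"
    by (simp only: set_map set image_ident)
qed

text \<open>
  For a point \<open>B\<close> this fails: the other facet of the segment \<open>Q\<close> is \<open>{a}\<close>, which does not meet \<open>B\<close>.
\<close>

theorem shelling_base_of_pyramid:
  assumes "shelling Q Fs" "Q = pyramid a B" "polytope B" "a \<notin> affine hull B" "1 \<le> aff_dim B"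
  shows "shelling B (map (\<lambda>F. F \<inter> B) (filter (\<lambda>F. F \<noteq> B) Fs))"
  using assms
proof (induction arbitrary: a B rule: shelling.induct)
  case (points Fs Q)
  \<comment> \<open>Impossible case: the base is a facet of \<open>Q\<close>, hence would be a
    point, against the bound on its dimension.\<close>
  have "B facet_of Q" using points by (simp add: facet_of_pyramid_iff)
  moreover have Fs: "set Fs = {F. F facet_of pyramid a B}" using points by simp
  ultimately obtain x where "B = {x}" using points by blast
  with points show ?case by simp
next
  case (step Fs Q)
  note a = \<open>a \<notin> affine hull B\<close> and B = \<open>polytope B\<close> and dim = \<open>1 \<le> aff_dim B\<close>
  let ?P = "\<lambda>F. F \<noteq> B"
  let ?L = "map (\<lambda>F. F \<inter> B) (filter ?P Fs)"
  have setFs: "set Fs = {F. F facet_of pyramid a B}" using step by simp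
  note L = facets_of_base[OF B a dim \<open>distinct Fs\<close> setFs]
  show ?case
  \<comment> \<open>The facets of a segment are points, and any ordering of them is a shelling. The
    induction hypothesis could not serve here, since the bases of the facets would be points; in
    higher dimension they have dimension at least 1.\<close>
  proof (cases "aff_dim B = 1")
    case True
    then show ?thesis
      using L by (intro shelling.points) (auto dest: facet_points_of_segment)
  next
    case False
    have facet: "\<exists>G. G facet_of B \<and> F = pyramid a G \<and> F \<inter> B = G \<and> polytope G \<and> convex G \<and> G \<subseteq> B
      \<and> a \<notin> affine hull G \<and> 1 \<le> aff_dim G" if F: "F \<in> set Fs" "F \<noteq> B" for F
    proof -
      obtain G where G: "G facet_of B" "F = pyramid a G"
        using F setFs facet_of_pyramid_iff[OF B a dim] by auto
      then have "G face_of B" "G \<subseteq> B" "convex G"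
        using facet_of_imp_face_of facet_of_imp_subset face_of_imp_convex by blast+
      moreover have "1 \<le> aff_dim G" using G False dim by (simp add: facet_of_def)
      ultimately show ?thesis
        using G pyramid_Int_base[of G B a] B a face_of_polytope_polytope apex_notin_affine_hull_mono
        by blast
    qed
    \<comment> \<open>The induction hypothesis is bound to the existential witness: it speaks of the
      very shelling \<open>Gs\<close> whose first \<open>r\<close> facets make up the intersection.
      Witness and restricted shelling are therefore extracted together.\<close>
    have IH2: "\<exists>Gs r. shelling (Fs ! j) Gs \<and> r \<le> length Gs \<and>
        Fs ! j \<inter> (\<Union>i<j. Fs ! i) = \<Union>(set (take r Gs)) \<and>
        shelling G (map (\<lambda>F. F \<inter> G) (filter (\<lambda>F. F \<noteq> G) Gs))"
      if j: "1 \<le> j" "j < length Fs" and G: "Fs ! j = pyramid a G" "polytope G" "a \<notin> affine hull G" "1 \<le> aff_dim G"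
      for j G
      using step.IH(2)[rule_format, OF conjI[OF j]]
      apply (elim conjE exE)
      subgoal for Gs r
        apply (rule exI[of _ Gs], rule exI[of _ r])
        using G by simp
      done
    \<comment> \<open>Needed for arbitrary positions: if the base comes first in \<open>Fs\<close>,
      the head of the shortened list stems from \<open>Fs ! 1\<close>, otherwise from
      \<open>hd Fs\<close>.\<close>
    have ind: "\<exists>Gs. shelling (F \<inter> B) Gs" if F: "F \<in> set Fs" "F \<noteq> B" for F
    proof -
      obtain j where j: "j < length Fs" "F = Fs ! j" using F by (metis in_set_conv_nth)
      obtain G where G: "F = pyramid a G" "F \<inter> B = G" "polytope G" "a \<notin> affine hull G" "1 \<le> aff_dim G"
        using facet[OF F] by blast
      show ?thesis
      proof (cases "j = 0")
        case True
        then have "F = hd Fs" using j by (simp add: hd_conv_nth)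
        then show ?thesis using step.IH(1) G by blast
      next
        case False
        then have "1 \<le> j" by simp
        then show ?thesis using IH2[of j G] G j by metis
      qed
    qed
    have ne: "?L \<noteq> []"
    proof -
      obtain G where "G facet_of B" using polytope_facet_exists[OF B] dim by fastforce
      with L(2) have "G \<in> set ?L" by simp
      then show ?thesis by (metis empty_iff list.set(1))
    qed
    have hd: "\<exists>Gs. shelling (hd ?L) Gs"
    proof -
      from ne have "filter ?P Fs \<noteq> []" by simp
      then have "hd (filter ?P Fs) \<in> set (filter ?P Fs)" by (rule list.set_sel)
      then show ?thesis using ind ne by (simp add: hd_map)
    qed
    have "?L ! j \<inter> (\<Union>i<j. ?L ! i) \<noteq> {} \<and>
        (\<exists>Gs r. shelling (?L ! j) Gs \<and> 1 \<le> r \<and> r \<le> length Gs \<and>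
                ?L ! j \<inter> (\<Union>i<j. ?L ! i) = \<Union>(set (take r Gs)))"
      if j: "1 \<le> j" "j < length ?L" for j
    proof -
      have "j < length (filter ?P Fs)" using j by simp
      then obtain m where m: "m < length Fs" "filter ?P Fs ! j = Fs ! m" "?P (Fs ! m)"
        and tk: "take j (filter ?P Fs) = filter ?P (take m Fs)"
        by (rule filter_nthE)
      define Pre where "Pre = set (filter ?P (take m Fs))"
      have "Pre \<noteq> {}" unfolding Pre_def tk[symmetric] using j by auto
      then obtain F0 where F0: "F0 \<in> Pre" by blast
      then have "m \<ge> 1" by (cases m) (auto simp: Pre_def)
      have PreFs: "F \<in> set Fs \<and> F \<noteq> B" if "F \<in> Pre" for F
        using that by (auto simp: Pre_def dest: in_set_takeD)
      have "Fs ! m \<in> set Fs" using m by simp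
      then obtain G where G: "G facet_of B" "Fs ! m = pyramid a G" "Fs ! m \<inter> B = G" "polytope G"
        "convex G" "G \<subseteq> B" "a \<notin> affine hull G" "1 \<le> aff_dim G"
        using facet m(3) by blast
      have Lj: "?L ! j = G" using j m G by simp
      have Un_L: "(\<Union>i<j. ?L ! i) = (\<Union>F\<in>Pre. F \<inter> B)"
        using j by (subst UN_nth_eq_take) (auto simp: take_map tk Pre_def)
      obtain Hs r where Hs: "shelling (Fs ! m) Hs" "r \<le> length Hs"
          "shelling G (map (\<lambda>F. F \<inter> G) (filter (\<lambda>F. F \<noteq> G) Hs))"
        and eq: "Fs ! m \<inter> (\<Union>i<m. Fs ! i) = \<Union> (set (take r Hs))"
        using IH2[OF \<open>m \<ge> 1\<close> m(1) G(2,4,7,8)] by blast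
      have eq: "pyramid a G \<inter> \<Union> (set (take m Fs)) = \<Union> (set (take r Hs))"
        using eq m(1) G(2) by (simp add: UN_nth_eq_take)
      \<comment> \<open>When \<open>B\<close> precedes \<open>Fs ! m\<close>, it contributes all of
        \<open>G\<close> to the intersection, so \<open>G\<close> may occur among the first
        \<open>r\<close> facets. It is dropped, and \<open>r'\<close> counts those that
        remain.\<close>
      define Hf where "Hf = filter (\<lambda>F. F \<noteq> G) (take r Hs)"
      define r' where "r' = length Hf"
      let ?M = "map (\<lambda>F. F \<inter> G) (filter (\<lambda>F. F \<noteq> G) Hs)"
      have split: "filter (\<lambda>F. F \<noteq> G) Hs = Hf @ filter (\<lambda>F. F \<noteq> G) (drop r Hs)"
        unfolding Hf_def by (metis append_take_drop_id filter_append)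
      have takeM: "take r' ?M = map (\<lambda>F. F \<inter> G) Hf"
        by (simp add: split r'_def)
      have r'_le: "r' \<le> length ?M" by (simp add: split r'_def)
      have Hfacet: "\<exists>K. K facet_of G \<and> H = pyramid a K \<and> H \<inter> G = K \<and> convex K \<and> K \<subseteq> G"
        if "H \<in> set Hf" for H
      proof -
        have "H \<in> set Hs" "H \<noteq> G" using that by (auto simp: Hf_def dest: in_set_takeD)
        moreover have "set Hs = {F. F facet_of pyramid a G}"
          using shelling_facets[OF Hs(1)] G by simp
        ultimately obtain K where K: "K facet_of G" "H = pyramid a K"
          using facet_of_pyramid_iff G by blast
        then have "K \<subseteq> G" "convex K"
          using facet_of_imp_face_of facet_of_imp_subset face_of_imp_convex by blast+
        then show ?thesis using K pyramid_Int_base[of K G a] G by blast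
      qed
      \<comment> \<open>Midpoints with the apex tell pyramids over subsets of \<open>G\<close> apart and avoid the bases \<open>G\<close> and \<open>B\<close>,
        which may be among the facets in \<open>eq\<close>.\<close>
      have main: "G \<inter> (\<Union>F\<in>Pre. F \<inter> B) = (\<Union>H\<in>set Hf. H \<inter> G)"
      proof (intro equalityI subsetI)
        fix x assume x: "x \<in> G \<inter> (\<Union>F\<in>Pre. F \<inter> B)"
        then obtain F where F: "F \<in> Pre" "x \<in> F" "x \<in> B" "x \<in> G" by blast
        obtain G' where "F = pyramid a G'" "F \<inter> B = G'" using facet PreFs F(1) by blast
        then have "midpoint a x \<in> F" using F midpoint_in_pyramid by blast
        moreover have "midpoint a x \<in> pyramid a G" using F midpoint_in_pyramid by blast
        ultimately have "midpoint a x \<in> \<Union> (set (take r Hs))"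
          using F(1) unfolding eq[symmetric] by (auto simp: Pre_def)
        moreover have "midpoint a x \<notin> G" using F(4) G(7) by (rule midpoint_apex_notin_base)
        ultimately obtain H where H: "H \<in> set Hf" "midpoint a x \<in> H" by (auto simp: Hf_def)
        then obtain K where "H = pyramid a K" "H \<inter> G = K" "convex K" "K \<subseteq> G" using Hfacet by blast
        then have "x \<in> H \<inter> G" using H F(4) G(7) midpoint_in_pyramidD by metis
        with H show "x \<in> (\<Union>H\<in>set Hf. H \<inter> G)" by blast
      next
        fix x assume "x \<in> (\<Union>H\<in>set Hf. H \<inter> G)"
        then obtain H where H: "H \<in> set Hf" "x \<in> H" "x \<in> G" by blast
        then obtain K where "H = pyramid a K" "H \<inter> G = K" using Hfacet by blast
        then have "midpoint a x \<in> H" using H midpoint_in_pyramid by blast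
        then have "midpoint a x \<in> \<Union> (set (take r Hs))" using H(1) by (auto simp: Hf_def)
        then obtain F where F: "F \<in> set (take m Fs)" "midpoint a x \<in> F" unfolding eq[symmetric] by blast
        have xB: "x \<in> B" using H G by blast
        then have "F \<noteq> B" using F midpoint_apex_notin_base a by blast
        then have FP: "F \<in> Pre" using F by (simp add: Pre_def)
        then obtain G' where "F = pyramid a G'" "F \<inter> B = G'" "convex G'" "G' \<subseteq> B"
          using facet PreFs by blast
        then have "x \<in> F \<inter> B" using midpoint_in_pyramidD F(2) xB a by metis
        with FP H show "x \<in> G \<inter> (\<Union>F\<in>Pre. F \<inter> B)" by blast
      qed
      \<comment> \<open>The apex witnesses this: it lies in \<open>Fs ! m\<close> and in the earlier
        facet \<open>F0\<close>, but not in \<open>G\<close>, so one of the first \<open>r\<close>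
        facets other than \<open>G\<close> contains it.\<close>
      have "Hf \<noteq> []"
      proof -
        obtain G' where "F0 = pyramid a G'" using facet PreFs F0 by blast
        then have "a \<in> pyramid a G \<inter> \<Union> (set (take m Fs))" using F0 by (auto simp: Pre_def)
        then obtain H where "H \<in> set (take r Hs)" "a \<in> H" unfolding eq by blast
        moreover have "a \<notin> G" using G apex_notin_base by blast
        ultimately have "H \<in> set Hf" by (auto simp: Hf_def)
        then show ?thesis by auto
      qed
      then obtain H where "H \<in> set Hf" by (cases Hf) auto
      then have "H \<inter> G \<noteq> {}" using Hfacet facet_of_def by metis
      then have nonempty: "(\<Union>H\<in>set Hf. H \<inter> G) \<noteq> {}" using \<open>H \<in> set Hf\<close> by blast
      have "r' \<ge> 1" using \<open>Hf \<noteq> []\<close> by (cases Hf) (auto simp: r'_def)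
      have "\<Union> (set (take r' ?M)) = (\<Union>H\<in>set Hf. H \<inter> G)" unfolding takeM by simp
      then show ?thesis
        unfolding Lj Un_L main
        using nonempty Hs(3) \<open>r' \<ge> 1\<close> r'_le by metis
    qed
    then show ?thesis using L ne hd by (intro shelling.step) auto
  qed
qed

section \<open>Affine embeddings\<close>

lemma face_of_affine_image:
  assumes "linear g" "inj g"
  shows "(\<lambda>y. c + g y) ` F face_of (\<lambda>y. c + g y) ` S \<longleftrightarrow> F face_of S"
proof -
  have *: "(\<lambda>y. c + g y) ` X = (+) c ` g ` X" for X by (simp add: image_image)
  show ?thesis unfolding * by (simp add: face_of_linear_image assms)
qed

lemma aff_dim_affine_image:
  fixes g :: "'a::euclidean_space \<Rightarrow> 'b::euclidean_space"
  assumes "linear g" "inj g"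
  shows "aff_dim ((\<lambda>y. c + g y) ` S) = aff_dim S"
proof -
  have *: "(\<lambda>y. c + g y) ` X = (+) c ` g ` X" for X by (simp add: image_image)
  show ?thesis unfolding * by (simp add: aff_dim_translation_eq aff_dim_injective_linear_image assms)
qed

lemma inj_affine:
  fixes g :: "'a::real_vector \<Rightarrow> 'b::real_vector"
  shows "inj g \<Longrightarrow> inj (\<lambda>y. c + g y)"
  by (rule injI) (simp add: inj_eq)

lemma vimage_faces:
  fixes g :: "'a::euclidean_space \<Rightarrow> 'b::euclidean_space"
  assumes g: "linear g" "inj g" and S: "S \<subseteq> range (\<lambda>y. c + g y)"
  shows "F face_of (\<lambda>y. c + g y) -` S \<longleftrightarrow> (\<lambda>y. c + g y) ` F face_of S"
proof -
  have "(\<lambda>y. c + g y) ` (\<lambda>y. c + g y) -` S = S"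
    unfolding image_vimage_eq using S by (rule Int_absorb2)
  then show ?thesis using face_of_affine_image[OF g, of c F "(\<lambda>y. c + g y) -` S"] by (simp only:)
qed

text \<open>On subsets of the range of an injective map, image and preimage are inverse to each
  other, so no inverse of the embedding has to be chosen.\<close>

lemma bij_betw_vimage_faces:
  fixes g :: "'a::euclidean_space \<Rightarrow> 'b::euclidean_space"
  assumes g: "linear g" "inj g" and S: "S \<subseteq> range (\<lambda>y. c + g y)"
  shows "bij_betw (vimage (\<lambda>y. c + g y)) {F. F face_of S} {F. F face_of (\<lambda>y. c + g y) -` S}"
proof (rule bij_betw_byWitness[where f' = "image (\<lambda>y. c + g y)"])
  let ?h = "\<lambda>y. c + g y"
  have im: "?h ` (?h -` F) = F" if "F face_of S" for F
    using face_of_imp_subset[OF that] S by auto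
  then show "\<forall>F\<in>{F. F face_of S}. ?h ` ?h -` F = F" by blast
  show "\<forall>F\<in>{F. F face_of ?h -` S}. ?h -` ?h ` F = F"
    using inj_affine[OF g(2)] by (simp add: inj_vimage_image_eq)
  show "vimage ?h ` {F. F face_of S} \<subseteq> {F. F face_of ?h -` S}"
    using im by (auto simp: vimage_faces[OF g S])
  show "image ?h ` {F. F face_of ?h -` S} \<subseteq> {F. F face_of S}"
    by (auto simp: vimage_faces[OF g S])
qed

lemma bij_betw_vimage_facets:
  fixes g :: "'a::euclidean_space \<Rightarrow> 'b::euclidean_space"
  assumes g: "linear g" "inj g" and S: "S \<subseteq> range (\<lambda>y. c + g y)"
  shows "bij_betw (vimage (\<lambda>y. c + g y)) {F. F facet_of S} {F. F facet_of (\<lambda>y. c + g y) -` S}"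
proof -
  let ?h = "\<lambda>y. c + g y"
  have dim: "aff_dim (?h -` F) = aff_dim F" if "F \<subseteq> S" for F
    using aff_dim_affine_image[OF g, of c "?h -` F"] that S by (simp add: image_vimage_eq inf.absorb1)
  note bij = bij_betw_vimage_faces[OF g S]
  have iff: "?h -` F facet_of ?h -` S \<longleftrightarrow> F facet_of S" if F: "F face_of S" for F
  proof -
    have "?h -` F face_of ?h -` S" using bij F by (auto simp: bij_betw_def)
    moreover have "F \<subseteq> S" using F by (rule face_of_imp_subset)
    ultimately show ?thesis using F S dim[of F] dim[of S] by (auto simp: facet_of_def)
  qed
  show ?thesis
  proof (rule bij_betw_subset[OF bij])
    show "{F. F facet_of S} \<subseteq> {F. F face_of S}" using facet_of_imp_face_of by blast
    show "vimage ?h ` {F. F facet_of S} = {F. F facet_of ?h -` S}"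
    proof (intro equalityI subsetI)
      fix K assume K: "K \<in> {F. F facet_of ?h -` S}"
      then have "K \<in> vimage ?h ` {F. F face_of S}"
        using bij by (simp add: bij_betw_def facet_of_imp_face_of)
      then show "K \<in> vimage ?h ` {F. F facet_of S}" using iff K by blast
    qed (use iff facet_of_imp_face_of in blast)
  qed
qed

text \<open>Affine maps commute with convex hulls, so the preimage of a finite generating set
  generates the preimage.\<close>

lemma polytope_vimage:
  fixes g :: "'a::euclidean_space \<Rightarrow> 'b::euclidean_space"
  assumes g: "linear g" "inj g" and S: "S \<subseteq> range (\<lambda>y. c + g y)" and "polytope S"
  shows "polytope ((\<lambda>y. c + g y) -` S)"
proof -
  let ?h = "\<lambda>y. c + g y"
  obtain V where V: "finite V" "S = convex hull V" using \<open>polytope S\<close> by (auto simp: polytope_def)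
  have im: "?h ` X = (+) c ` g ` X" for X by (simp add: image_image)
  have "V \<subseteq> range ?h" using V S hull_subset[of V convex] by (meson subset_trans equalityD2)
  then have "?h ` (?h -` V) = V" by (simp add: image_vimage_eq inf.absorb1)
  then have "S = convex hull (?h ` (?h -` V))" using V by simp
  also have "\<dots> = ?h ` (convex hull (?h -` V))"
    unfolding im by (simp add: convex_hull_translation convex_hull_linear_image g)
  finally have "?h -` S = convex hull (?h -` V)"
    using inj_affine[OF g(2)] by (simp add: inj_vimage_image_eq)
  moreover have "finite (?h -` V)" using V inj_affine[OF g(2)] by (intro finite_vimageI)
  ultimately show ?thesis by (simp add: polytope_convex_hull)
qed

text \<open>A shelling involves only facets, intersections, unions and non-emptiness. Preimages
  respect intersections and unions in any case; for facets and for non-emptiness it matters that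
  \<open>S\<close> lies in the range.\<close>

lemma shelling_vimage:
  fixes g :: "'a::euclidean_space \<Rightarrow> 'b::euclidean_space"
  assumes g: "linear g" "inj g"
  shows "shelling S Fs \<Longrightarrow> S \<subseteq> range (\<lambda>y. c + g y) \<Longrightarrow>
    shelling ((\<lambda>y. c + g y) -` S) (map (vimage (\<lambda>y. c + g y)) Fs)"
proof (induction rule: shelling.induct)
  case (points Fs Q)
  note bij = bij_betw_vimage_facets[OF g \<open>Q \<subseteq> _\<close>]
  show ?case
  proof (rule shelling.points)
    show "distinct (map (vimage (\<lambda>y. c + g y)) Fs)"
      using points.hyps(1,2) bij by (simp add: distinct_map bij_betw_def)
    show "set (map (vimage (\<lambda>y. c + g y)) Fs) = {F. F facet_of (\<lambda>y. c + g y) -` Q}"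
      using points.hyps(1,2) bij by (simp add: bij_betw_def)
    have "\<exists>y. (\<lambda>y. c + g y) -` F = {y}" if F: "F \<in> set Fs" for F
    proof -
      obtain x where x: "F = {x}" using points.hyps(3) F by blast
      have "F \<subseteq> Q" using points.hyps(2) F by (simp add: facet_of_imp_subset)
      then have "x \<in> range (\<lambda>y. c + g y)" using x \<open>Q \<subseteq> _\<close> by (simp add: subset_iff)
      then obtain y where "x = c + g y" by blast
      then have "(\<lambda>y. c + g y) -` F = {y}" using x g(2) by (auto simp: inj_def)
      then show ?thesis ..
    qed
    then show "\<forall>F\<in>set (map (vimage (\<lambda>y. c + g y)) Fs). \<exists>x. F = {x}" by simp
  qed
next
  case (step Fs Q)
  let ?h = "\<lambda>y. c + g y"
  note bij = bij_betw_vimage_facets[OF g \<open>Q \<subseteq> _\<close>]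
  have sub: "F \<subseteq> range ?h" if "F \<in> set Fs" for F
    using step.hyps(2) step.prems that facet_of_imp_subset[of F Q] by (simp add: subset_trans)
  show ?case
  proof (rule shelling.step)
    show "distinct (map (vimage ?h) Fs)"
      using step.hyps(1,2) bij by (simp add: distinct_map bij_betw_def)
    show "set (map (vimage ?h) Fs) = {F. F facet_of ?h -` Q}"
      using step.hyps(1,2) bij by (simp add: bij_betw_def)
    show "map (vimage ?h) Fs \<noteq> []" using step.hyps(3) by simp
    show "\<exists>Gs. shelling (hd (map (vimage ?h) Fs)) Gs"
      using step.IH(1) step.hyps(3) sub[OF hd_in_set] by (auto simp: hd_map)
    show "\<forall>j. 1 \<le> j \<and> j < length (map (vimage ?h) Fs) \<longrightarrow>
        map (vimage ?h) Fs ! j \<inter> (\<Union>i<j. map (vimage ?h) Fs ! i) \<noteq> {} \<and>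
        (\<exists>Gs r. shelling (map (vimage ?h) Fs ! j) Gs \<and> 1 \<le> r \<and> r \<le> length Gs \<and>
          map (vimage ?h) Fs ! j \<inter> (\<Union>i<j. map (vimage ?h) Fs ! i) = \<Union>(set (take r Gs)))"
    proof (intro allI impI)
      fix j assume j: "1 \<le> j \<and> j < length (map (vimage ?h) Fs)"
      then have j': "1 \<le> j \<and> j < length Fs" by simp
      have Fj: "Fs ! j \<subseteq> range ?h" using sub j' by simp
      have eq: "map (vimage ?h) Fs ! j \<inter> (\<Union>i<j. map (vimage ?h) Fs ! i) = ?h -` (Fs ! j \<inter> (\<Union>i<j. Fs ! i))"
      proof -
        have "(\<Union>i<j. map (vimage ?h) Fs ! i) = (\<Union>i<j. ?h -` (Fs ! i))"
          using j' by (intro SUP_cong) simp_all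
        then show ?thesis using j' by (simp only: vimage_Int vimage_UN nth_map)
      qed
      note IH = step.IH(2)[rule_format, OF j']
      obtain Gs r where Gs: "shelling (?h -` (Fs ! j)) (map (vimage ?h) Gs)" "1 \<le> r" "r \<le> length Gs"
        "Fs ! j \<inter> (\<Union>i<j. Fs ! i) = \<Union>(set (take r Gs))"
        using IH[THEN conjunct2] Fj by (elim exE conjE impE) simp_all
      obtain x where x: "x \<in> Fs ! j \<inter> (\<Union>i<j. Fs ! i)" using IH[THEN conjunct1] by (meson equals0I)
      then have "x \<in> range ?h" using Fj by (simp add: subset_iff)
      then obtain y where "x = ?h y" by (elim rangeE)
      then have ne: "?h -` (Fs ! j \<inter> (\<Union>i<j. Fs ! i)) \<noteq> {}" using vimageI2[of ?h y, of "Fs ! j \<inter> (\<Union>i<j. Fs ! i)"] x by blast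
      have Un: "?h -` \<Union>(set (take r Gs)) = \<Union>(set (take r (map (vimage ?h) Gs)))"
        by (simp only: take_map set_map vimage_Union)
      show "map (vimage ?h) Fs ! j \<inter> (\<Union>i<j. map (vimage ?h) Fs ! i) \<noteq> {} \<and>
        (\<exists>Gs r. shelling (map (vimage ?h) Fs ! j) Gs \<and> 1 \<le> r \<and> r \<le> length Gs \<and>
          map (vimage ?h) Fs ! j \<inter> (\<Union>i<j. map (vimage ?h) Fs ! i) = \<Union>(set (take r Gs)))"
        unfolding eq
        by (rule conjI[OF ne], rule exI[of _ "map (vimage ?h) Gs"], rule exI[of _ r])
          (use Gs Un j' in \<open>simp only: nth_map length_map simp_thms\<close>)
    qed
  qed
qed

text \<open>A set that is not full-dimensional lies in a hyperplane, whose direction space has the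
  dimension of \<open>'a\<close> and is therefore a linear copy of it; a translation does the
  rest.\<close>

lemma affine_embedding_onto_hyperplane:
  fixes S :: "('a::euclidean_space \<times> real) set"
  assumes "aff_dim S \<le> DIM('a)"
  obtains c and g :: "'a \<Rightarrow> 'a \<times> real" where "linear g" "inj g" "S \<subseteq> range (\<lambda>y. c + g y)"
proof -
  have "aff_dim S < DIM('a \<times> real)" using assms by simp
  then obtain n b where n: "n \<noteq> 0" "S \<subseteq> {x. n \<bullet> x = b}" by (rule aff_lowdim_subset_hyperplane)
  have dim: "dim (UNIV :: 'a set) = dim {x. n \<bullet> x = 0}" using n(1) by (simp add: dim_hyperplane)
  have "\<exists>g::'a \<Rightarrow> 'a \<times> real. linear g \<and> inj g \<and> range g = {x. n \<bullet> x = 0}"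
  proof (rule isometries_subspaces[OF subspace_UNIV subspace_hyperplane dim])
    fix f :: "'a \<Rightarrow> 'a \<times> real" and k
    assume f: "linear f" "range f = {x. n \<bullet> x = 0}" "\<And>x. x \<in> UNIV \<Longrightarrow> k (f x) = x"
    have "inj f" using f(3) by (rule inj_on_inverseI)
    with f show ?thesis by blast
  qed
  then obtain g :: "'a \<Rightarrow> 'a \<times> real" where g: "linear g" "inj g" "range g = {x. n \<bullet> x = 0}" by blast
  \<comment> \<open>The foot of the perpendicular from the origin to the hyperplane, so that
    \<open>n \<bullet> c = b\<close>.\<close>
  define c where "c = (b / (n \<bullet> n)) *\<^sub>R n"
  have "S \<subseteq> range (\<lambda>y. c + g y)"
  proof
    fix x assume "x \<in> S"
    then have "n \<bullet> x = b" using n by auto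
    then have "n \<bullet> (x - c) = 0" using n(1) by (simp add: c_def inner_diff_right)
    then have "x - c \<in> range g" using g(3) by simp
    then obtain y where "x - c = g y" by (elim rangeE)
    then have "x = c + g y" by (simp add: algebra_simps)
    then show "x \<in> range (\<lambda>y. c + g y)" by (rule range_eqI)
  qed
  with g(1,2) show ?thesis by (rule that)
qed

section \<open>Polars of pyramids\<close>

text \<open>The assumption \<open>facet\<close> is read off from a shelling in the application:
  \<open>\<phi> {a}\<close> is an entry of a shelling of \<open>Q\<close>, and the entries are
  facets.\<close>

locale pyramid_polar =
  fixes a :: "'a::euclidean_space" and B Q :: "'a set" and \<phi> :: "'a set \<Rightarrow> 'a set"
  assumes B: "polytope B" and a: "a \<notin> affine hull B"
    and polar: "combinatorial_polar (pyramid a B) Q \<phi>"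
    and facet: "\<phi> {a} facet_of Q"
begin

lemma polytope_Q: "polytope Q"
  using polar by (simp add: combinatorial_polar_def)

lemma bij: "bij_betw \<phi> {F. F face_of pyramid a B} {F. F face_of Q}"
  using polar by (simp add: combinatorial_polar_def)

lemma polar_le_iff: "F face_of pyramid a B \<Longrightarrow> G face_of pyramid a B \<Longrightarrow> \<phi> G \<subseteq> \<phi> F \<longleftrightarrow> F \<subseteq> G"
  using polar by (simp add: combinatorial_polar_def)

lemma polar_face: "F face_of pyramid a B \<Longrightarrow> \<phi> F face_of Q"
  using bij_betw_apply[OF bij] by (simp only: mem_Collect_eq)

lemma polar_faceE:
  assumes "K face_of Q"
  obtains F where "F face_of pyramid a B" "\<phi> F = K"
proof -
  have "K \<in> \<phi> ` {F. F face_of pyramid a B}"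
    using bij assms by (simp add: bij_betw_def)
  then show ?thesis using that by blast
qed

lemma base_face: "F face_of B \<Longrightarrow> F face_of pyramid a B"
  and pyramid_face: "F face_of B \<Longrightarrow> pyramid a F face_of pyramid a B"
  unfolding face_of_pyramid_iff[OF B a] by blast+

lemma apex_face: "{a} face_of pyramid a B"
  using pyramid_face[of "{}"] by simp

lemma convex_B: "convex B"
  using B by (rule polytope_imp_convex)

lemma face_with_apexE:
  assumes "F face_of pyramid a B" "a \<in> F"
  obtains G where "G face_of B" "F = pyramid a G"
proof -
  have "\<not> F face_of B" using assms(2) apex_notin_base[OF a] face_of_imp_subset[of F B] by (meson subsetD)
  then have "\<exists>G. G face_of B \<and> F = pyramid a G" using assms(1) face_of_pyramid_iff[OF B a] by simp
  then show ?thesis using that by blast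
qed

text \<open>Faces of \<open>\<phi> {a}\<close> are the faces of \<open>Q\<close> below it, hence the
  images of the faces that contain \<open>a\<close>, and these are the pyramids over faces of
  \<open>B\<close>. This is what makes \<open>\<phi> {a}\<close> a polar of
  \<open>B\<close>.\<close>

lemma bij_betw_facet:
  "bij_betw (\<lambda>H. \<phi> (pyramid a H)) {H. H face_of B} {F. F face_of \<phi> {a}}"
  unfolding bij_betw_def
proof (intro conjI equalityI subsetI)
  show "inj_on (\<lambda>H. \<phi> (pyramid a H)) {H. H face_of B}"
  proof (rule inj_onI, clarsimp)
    fix F G assume "F face_of B" "G face_of B" "\<phi> (pyramid a F) = \<phi> (pyramid a G)"
    then show "F = G"
      using polar_le_iff[of "pyramid a F" "pyramid a G"] polar_le_iff[of "pyramid a G" "pyramid a F"]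
        face_of_pyramid_mono_iff[OF B a] pyramid_face by blast
  qed
next
  fix K assume "K \<in> (\<lambda>H. \<phi> (pyramid a H)) ` {H. H face_of B}"
  then obtain H where "H face_of B" "K = \<phi> (pyramid a H)" by blast
  then have "K face_of Q" "K \<subseteq> \<phi> {a}"
    using polar_face pyramid_face polar_le_iff[OF apex_face] by auto
  then show "K \<in> {F. F face_of \<phi> {a}}"
    using face_of_face[OF facet_of_imp_face_of[OF facet]] by simp
next
  fix K assume "K \<in> {F. F face_of \<phi> {a}}"
  then have K: "K face_of Q" "K \<subseteq> \<phi> {a}"
    using face_of_face[OF facet_of_imp_face_of[OF facet]] by auto
  obtain F where F: "F face_of pyramid a B" "\<phi> F = K" using polar_faceE K by blast
  then have "a \<in> F" using K polar_le_iff[OF apex_face, of F] by simp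
  then obtain G where "G face_of B" "F = pyramid a G" using F face_with_apexE by blast
  with F show "K \<in> (\<lambda>H. \<phi> (pyramid a H)) ` {H. H face_of B}" by blast
qed

text \<open>Order reversal turns the meet of two facets of \<open>Q\<close> into the join of the
  vertices \<open>w\<close> and \<open>a\<close>, which is the edge between them.\<close>

lemma facet_Int:
  assumes "{w} face_of B"
  shows "\<phi> {w} \<inter> \<phi> {a} = \<phi> (pyramid a {w})"
proof
  have "\<phi> {w} \<inter> \<phi> {a} face_of Q"
    using assms by (intro face_of_Int polar_face base_face apex_face)
  then obtain K where K: "K face_of pyramid a B" "\<phi> K = \<phi> {w} \<inter> \<phi> {a}"
    using polar_faceE by blast
  then have "w \<in> K" "a \<in> K"
    using polar_le_iff[OF base_face[OF assms], of K] polar_le_iff[OF apex_face, of K] by auto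
  then have "pyramid a {w} \<subseteq> K"
    using face_of_imp_convex[OF K(1)] by (simp add: pyramid_def hull_minimal)
  then show "\<phi> {w} \<inter> \<phi> {a} \<subseteq> \<phi> (pyramid a {w})"
    using K polar_le_iff[OF pyramid_face[OF assms], of K] by auto
  show "\<phi> (pyramid a {w}) \<subseteq> \<phi> {w} \<inter> \<phi> {a}"
    using assms polar_le_iff base_face pyramid_face apex_face subset_pyramid[of "{w}" a] by simp
qed

text \<open>A vertex of \<open>Q\<close> is \<open>\<phi> K\<close> for some face \<open>K\<close>.
  If \<open>K\<close> contains \<open>a\<close>, the vertex lies on \<open>\<phi> {a}\<close>;
  otherwise \<open>K\<close> is contained in \<open>B\<close>, and the vertex is the single point of
  \<open>\<phi> B\<close>. This point is the apex, and \<open>Q\<close> is the hull of its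
  vertices.\<close>

lemma Q_is_pyramid:
  obtains x where "x \<notin> affine hull \<phi> {a}" "Q = pyramid x (\<phi> {a})"
proof -
  have whole: "pyramid a B face_of pyramid a B"
    using pyramid_face[OF face_of_refl[OF convex_B]] .
  have BB: "B face_of pyramid a B" using base_face[OF face_of_refl[OF convex_B]] .
  have empty: "\<phi> (pyramid a B) = {}"
  proof -
    obtain K where K: "K face_of pyramid a B" "\<phi> K = {}" using polar_faceE[of "{}"] by auto
    then show ?thesis using polar_le_iff[OF K(1) whole] face_of_imp_subset by blast
  qed
  have vert: "x \<in> \<phi> {a} \<or> {x} = \<phi> B" if "x extreme_point_of Q" for x
  proof -
    have "{x} face_of Q" using that by (simp add: face_of_singleton)
    then obtain K where K: "K face_of pyramid a B" "\<phi> K = {x}" using polar_faceE by blast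
    show ?thesis
    proof (cases "a \<in> K")
      case True
      then show ?thesis using polar_le_iff[OF apex_face K(1)] K by auto
    next
      case False
      then have "K face_of B" using K(1) face_of_pyramid_iff[OF B a] by auto
      then have "\<phi> B \<subseteq> {x}" using K polar_le_iff[OF K(1) BB] face_of_imp_subset by blast
      moreover have "\<phi> B \<noteq> {}"
      proof
        assume "\<phi> B = {}"
        then have "pyramid a B \<subseteq> B" using empty polar_le_iff[OF whole BB] by simp
        then show False using apex_notin_base[OF a] apex_in_pyramid[of a B] by blast
      qed
      ultimately show ?thesis by blast
    qed
  qed
  have facet_subset: "\<phi> {a} \<subseteq> Q" using facet by (rule facet_of_imp_subset)
  have convF: "convex (\<phi> {a})" using facet facet_of_imp_face_of face_of_imp_convex by blast
  have KM: "Q = convex hull {x. x extreme_point_of Q}"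
    using polytope_Q by (simp add: Krein_Milman_Minkowski polytope_imp_compact polytope_imp_convex)
  have "\<exists>x. x extreme_point_of Q \<and> x \<notin> \<phi> {a}"
  proof (rule ccontr)
    assume "\<nexists>x. x extreme_point_of Q \<and> x \<notin> \<phi> {a}"
    then have "convex hull {x. x extreme_point_of Q} \<subseteq> \<phi> {a}"
      using convF by (intro hull_minimal) auto
    then have "Q = \<phi> {a}" using KM facet_subset by simp
    then show False using facet by (metis facet_of_irrefl)
  qed
  then obtain x where x: "x extreme_point_of Q" "x \<notin> \<phi> {a}" by blast
  then have xB: "{x} = \<phi> B" using vert by blast
  have "Q = pyramid x (\<phi> {a})"
  proof
    have "{x. x extreme_point_of Q} \<subseteq> insert x (\<phi> {a})" using vert xB by blast
    then show "Q \<subseteq> pyramid x (\<phi> {a})" unfolding pyramid_def using KM hull_mono by metis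
    have "x \<in> Q" using x by (simp add: extreme_point_of_def)
    then show "pyramid x (\<phi> {a}) \<subseteq> Q"
      unfolding pyramid_def using facet_subset polytope_Q by (intro hull_minimal) (auto simp: polytope_imp_convex)
  qed
  moreover have "x \<notin> affine hull \<phi> {a}"
  proof -
    \<comment> \<open>A face is cut out of the polytope by its own affine hull, so a vertex off the
      face is off the hull too.\<close>
    have "\<phi> {a} = (affine hull \<phi> {a}) \<inter> Q"
      using facet polytope_Q by (intro face_of_imp_eq_affine_Int) (auto simp: facet_of_imp_face_of polytope_imp_convex)
    then show ?thesis using x by (auto simp: extreme_point_of_def)
  qed
  ultimately show ?thesis using that by blast
qed

lemma polytope_facet: "polytope (\<phi> {a})"
  using face_of_polytope_polytope[OF polytope_Q facet_of_imp_face_of[OF facet]] .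

text \<open>The bijection of faces gives no dimension directly, so faces are counted:
  \<open>B\<close> has at least the three faces \<open>{}\<close>, \<open>{w}\<close> and
  \<open>B\<close>, a point has only two.\<close>

lemma aff_dim_facet:
  assumes "1 \<le> aff_dim B"
  shows "1 \<le> aff_dim (\<phi> {a})"
proof (rule ccontr)
  assume "\<not> 1 \<le> aff_dim (\<phi> {a})"
  moreover have "\<phi> {a} \<noteq> {}" using facet by (simp add: facet_of_def)
  ultimately have "aff_dim (\<phi> {a}) = 0"
    using aff_dim_geq[of "\<phi> {a}"] aff_dim_empty[of "\<phi> {a}"] by linarith
  then obtain x where x: "\<phi> {a} = {x}" by (auto simp: aff_dim_eq_0)
  have "B \<noteq> {}" using assms by auto
  then obtain w where "w \<in> vertices_of B" using B polytope_vertex_exists by blast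
  then have w: "{w} face_of B" by (simp add: vertices_of_def face_of_singleton)
  let ?S = "{{}, {w}, B}"
  have "B \<noteq> {w}" using assms by auto
  then have "card ?S = 3" using \<open>B \<noteq> {}\<close> by auto
  moreover have "?S \<subseteq> {H. H face_of B}" using w convex_B by (auto simp: face_of_refl)
  ultimately have sub: "?S \<subseteq> {H. H face_of B}" and card: "card ?S = 3" by simp_all
  have inj: "inj_on (\<lambda>H. \<phi> (pyramid a H)) ?S"
    using bij_betw_imp_inj_on[OF bij_betw_facet] sub by (rule inj_on_subset)
  have "(\<lambda>H. \<phi> (pyramid a H)) ` ?S \<subseteq> (\<lambda>H. \<phi> (pyramid a H)) ` {H. H face_of B}"
    using sub by (rule image_mono)
  also have "\<dots> = {F. F face_of \<phi> {a}}"
    by (rule bij_betw_imp_surj_on[OF bij_betw_facet])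
  finally have "(\<lambda>H. \<phi> (pyramid a H)) ` ?S \<subseteq> {F. F face_of \<phi> {a}}" .
  then have "(\<lambda>H. \<phi> (pyramid a H)) ` ?S \<subseteq> Pow {x}"
    using x face_of_imp_subset by fastforce
  then have "card ((\<lambda>H. \<phi> (pyramid a H)) ` ?S) \<le> card (Pow {x})" by (intro card_mono) auto
  then show False unfolding card_image[OF inj] card by (simp add: card_Pow)
qed

lemma shelling_facet:
  assumes sh: "shelling Q (map (\<lambda>w. \<phi> {w}) (ws @ [a]))"
    and ws: "set ws \<subseteq> vertices_of B" and dim: "1 \<le> aff_dim B"
  shows "shelling (\<phi> {a}) (map (\<lambda>w. \<phi> (pyramid a {w})) ws)"
proof -
  obtain x where x: "x \<notin> affine hull \<phi> {a}" "Q = pyramid x (\<phi> {a})" by (rule Q_is_pyramid)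
  \<comment> \<open>The entries of a shelling are distinct, so the deletion of the base removes the
    last entry and nothing else.\<close>
  have "filter (\<lambda>F. F \<noteq> \<phi> {a}) (map (\<lambda>w. \<phi> {w}) (ws @ [a])) = map (\<lambda>w. \<phi> {w}) ws"
    using shelling_facets[OF sh] by (auto simp: filter_id_conv)
  moreover have "map (\<lambda>F. F \<inter> \<phi> {a}) (map (\<lambda>w. \<phi> {w}) ws) = map (\<lambda>w. \<phi> (pyramid a {w})) ws"
    using ws by (auto simp: vertices_of_def face_of_singleton intro!: facet_Int)
  ultimately show ?thesis
    using shelling_base_of_pyramid[OF sh x(2) polytope_facet x(1) aff_dim_facet[OF dim]] by (simp only:)
qed

end

section \<open>Directed paths\<close>

text \<open>
  The direct edge from \<open>s\<close> to \<open>t\<close>, if it is one of the paths, must be the one that is extended through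
  \<open>t\<close>: cut off before \<open>t\<close> it would become the edge from \<open>s\<close> to \<open>v\<close>, which is already in use.
\<close>

lemma dipaths_to_apex:
  assumes Ps: "finite Ps" "\<And>p. p \<in> Ps \<Longrightarrow> dipath A s p t"
      "\<And>p q. p \<in> Ps \<Longrightarrow> q \<in> Ps \<Longrightarrow> p \<noteq> q \<Longrightarrow> set p \<inter> set q \<subseteq> {s, t}"
    and st: "Ps \<noteq> {} \<Longrightarrow> s \<noteq> t"
    and A: "A \<subseteq> A'" and to_v: "(s, v) \<in> A'" "\<And>p x. p \<in> Ps \<Longrightarrow> x \<in> set p \<Longrightarrow> (x, v) \<in> A'"
    and v: "s \<noteq> v" "\<And>p. p \<in> Ps \<Longrightarrow> v \<notin> set p"
  shows "\<exists>Qs. finite Qs \<and> card Qs = Suc (card Ps) \<and> (\<forall>p\<in>Qs. dipath A' s p v) \<and>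
    (\<forall>p\<in>Qs. \<forall>q\<in>Qs. p \<noteq> q \<longrightarrow> set p \<inter> set q \<subseteq> {s, v})"
proof (cases "Ps = {}")
  \<comment> \<open>This occurs when the face of the base is a single vertex; the edge from it to
    \<open>v\<close> is then the only path required.\<close>
  case True
  then show ?thesis
    using to_v v by (intro exI[of _ "{[s, v]}"]) (simp add: dipath_def)
next
  case False
  then have "s \<noteq> t" by (rule st)
  define p0 where "p0 = (if [s, t] \<in> Ps then [s, t] else SOME p. p \<in> Ps)"
  have p0: "p0 \<in> Ps" "[s, t] \<in> Ps \<Longrightarrow> p0 = [s, t]"
    using False by (simp_all add: p0_def some_in_eq)
  define g where "g p = (if p = p0 then p else butlast p)" for p
  have path: "p \<noteq> []" "hd p = s" "last p = t" "distinct p" "successively (\<lambda>u w. (u, w) \<in> A) p"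
    if "p \<in> Ps" for p
    using Ps(2)[OF that] by (simp_all add: dipath_def)
  have but: "butlast p @ [t] = p" "butlast p \<noteq> []" "hd (butlast p) = s" "t \<notin> set (butlast p)"
    if p: "p \<in> Ps" for p
  proof -
    show eq: "butlast p @ [t] = p"
      using append_butlast_last_id[OF path(1)[OF p]] unfolding path(3)[OF p] .
    show ne: "butlast p \<noteq> []"
    proof
      assume "butlast p = []"
      then have "p = [t]" using eq by simp
      then show False using path(2)[OF p] \<open>s \<noteq> t\<close> by simp
    qed
    then show "hd (butlast p) = s" using path(2)[OF p] hd_append2[OF ne, of "[t]"] unfolding eq by simp
    have "distinct (butlast p @ [t])" unfolding eq by (rule path(4)[OF p])
    then show "t \<notin> set (butlast p)" by simp
  qed
  have g: "g p \<noteq> []" "hd (g p) = s" "distinct (g p)" "set (g p) \<subseteq> set p"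
      "successively (\<lambda>u w. (u, w) \<in> A) (g p)" "p \<noteq> p0 \<Longrightarrow> t \<notin> set (g p)" "p \<noteq> p0 \<Longrightarrow> g p \<noteq> [s]"
      "g p0 = p0" if p: "p \<in> Ps" for p
  proof -
    show "g p \<noteq> []" "hd (g p) = s" "p \<noteq> p0 \<Longrightarrow> t \<notin> set (g p)" "g p0 = p0"
      using path(1,2)[OF p] but(2-4)[OF p] unfolding g_def by auto
    show "distinct (g p)" "set (g p) \<subseteq> set p"
      using path(4)[OF p] by (auto simp: g_def distinct_butlast dest: in_set_butlastD)
    have "successively (\<lambda>u w. (u, w) \<in> A) (butlast p @ [t])"
      unfolding but(1)[OF p] by (rule path(5)[OF p])
    then show "successively (\<lambda>u w. (u, w) \<in> A) (g p)"
      using path(5)[OF p] unfolding g_def successively_append_iff by auto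
    show "g p \<noteq> [s]" if "p \<noteq> p0"
    proof
      assume "g p = [s]"
      then have "butlast p = [s]" using that by (simp add: g_def)
      then have "p = [s, t]" using but(1)[OF p] by simp
      then show False using p0(2) p that by simp
    qed
  qed
  \<comment> \<open>The image of \<open>p0\<close> still contains \<open>t\<close>, the shortened
    paths do not; among the latter, appending \<open>t\<close> restores the original.\<close>
  have "inj_on g Ps"
  proof (rule inj_onI)
    fix p q assume pq: "p \<in> Ps" "q \<in> Ps" "g p = g q"
    have t: "t \<in> set p0" using last_in_set[OF path(1)[OF p0(1)]] unfolding path(3)[OF p0(1)] .
    have "t \<in> set (g p0)" using t unfolding g(8)[OF p0(1)] .
    then have "p = p0 \<longleftrightarrow> q = p0"
      using g(6)[OF pq(1)] g(6)[OF pq(2)] pq(3) by (cases "p = p0"; cases "q = p0") simp_all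
    show "p = q"
    proof (cases "p = p0")
      case True
      then show ?thesis using \<open>p = p0 \<longleftrightarrow> q = p0\<close> by simp
    next
      case False
      then have "butlast p = butlast q" using pq(3) \<open>p = p0 \<longleftrightarrow> q = p0\<close> by (simp add: g_def)
      then have "butlast p @ [t] = butlast q @ [t]" by (rule arg_cong)
      then show ?thesis unfolding but(1)[OF pq(1)] but(1)[OF pq(2)] .
    qed
  qed
  have inj: "inj_on (\<lambda>p. g p @ [v]) Ps"
  proof (rule inj_onI)
    fix p q assume "p \<in> Ps" "q \<in> Ps" "g p @ [v] = g q @ [v]"
    then show "p = q" using inj_onD[OF \<open>inj_on g Ps\<close>, of p q] by simp
  qed
  have direct: "[s, v] \<notin> (\<lambda>p. g p @ [v]) ` Ps"
  proof
    assume "[s, v] \<in> (\<lambda>p. g p @ [v]) ` Ps"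
    then obtain p where p: "p \<in> Ps" "g p = [s]" by auto
    then have "p = p0" using g(7) by blast
    then have "p0 = [s]" using p g(8)[OF p0(1)] by simp
    then show False using but(2)[OF p0(1)] by simp
  qed
  have dip: "dipath A' s (g p @ [v]) v" if p: "p \<in> Ps" for p
  proof -
    have "successively (\<lambda>u w. (u, w) \<in> A') (g p)"
      using g(5)[OF p] by (rule successively_mono) (use A in auto)
    moreover have "(last (g p), v) \<in> A'" "v \<notin> set (g p)"
      using to_v(2)[OF p] v(2)[OF p] g(1,4)[OF p] last_in_set[OF g(1)[OF p]] by blast+
    ultimately show ?thesis
      using g(1-3)[OF p] by (simp add: dipath_def successively_append_iff)
  qed
  \<comment> \<open>At most one of the modified paths still passes through \<open>t\<close>, so of
    the two permitted common points only \<open>s\<close> is left.\<close>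
  have disj: "set (g p) \<inter> set (g q) \<subseteq> {s}" if pq: "p \<in> Ps" "q \<in> Ps" "p \<noteq> q" for p q
  proof -
    have "t \<notin> set (g p) \<or> t \<notin> set (g q)" using pq g(6) by metis
    then show ?thesis using Ps(3)[OF pq] g(4)[OF pq(1)] g(4)[OF pq(2)] by blast
  qed
  let ?Qs = "insert [s, v] ((\<lambda>p. g p @ [v]) ` Ps)"
  have "card ?Qs = Suc (card Ps)" using direct Ps(1) by (simp add: card_image[OF inj])
  moreover have "\<forall>p\<in>?Qs. dipath A' s p v"
    using dip to_v(1) v(1) by (auto simp: dipath_def)
  moreover have "set p \<inter> set q \<subseteq> {s, v}" if "p \<in> ?Qs" "q \<in> ?Qs" "p \<noteq> q" for p q
  proof -
    consider "p = [s, v] \<or> q = [s, v]"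
      | p' q' where "p' \<in> Ps" "q' \<in> Ps" "p = g p' @ [v]" "q = g q' @ [v]"
      using \<open>p \<in> ?Qs\<close> \<open>q \<in> ?Qs\<close> by blast
    then show ?thesis
    proof cases
      case (2 p' q')
      then have "p' \<noteq> q'" using \<open>p \<noteq> q\<close> by blast
      then show ?thesis using disj[of p' q'] 2 by auto
    qed auto
  qed
  ultimately show ?thesis using Ps(1) by (intro exI[of _ ?Qs]) simp
qed

lemma dipath_map:
  assumes "dipath A s p t" "inj f" "\<And>u w. (u, w) \<in> A \<Longrightarrow> (f u, f w) \<in> B"
  shows "dipath B (f s) (map f p) (f t)"
proof -
  have "successively (\<lambda>u w. (f u, f w) \<in> B) p"
    using assms(1,3) unfolding dipath_def by (elim conjE) (rule successively_mono)
  then show ?thesis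
    using assms(1,2) by (simp add: dipath_def hd_map last_map distinct_map successively_map inj_on_subset[OF assms(2) subset_UNIV])
qed

text \<open>Every vertex of a path with an edge belongs to \<open>H\<close> because the edges do;
  the assumption on \<open>s\<close> covers the path without edges.\<close>

lemma dipath_vertices:
  assumes "dipath (induced_digraph E H) s p t" "s \<in> vertices_of H"
  shows "set p \<subseteq> vertices_of H"
proof -
  have *: "successively (\<lambda>u w. (u, w) \<in> induced_digraph E H) p \<Longrightarrow> p \<noteq> [] \<Longrightarrow> hd p \<in> vertices_of H \<Longrightarrow>
    set p \<subseteq> vertices_of H" for p
  proof (induction p rule: induct_list012)
    case (3 x y zs)
    then show ?case by (simp add: induced_digraph_def)
  qed auto
  show ?thesis using assms by (intro *) (auto simp: dipath_def)
qed

section \<open>Pyramids of polytopal digraphs\<close>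

lemma linear_Pair_0: "linear (\<lambda>x::'a::real_vector. (x, 0::real))"
  by (rule linearI) auto

lemma Times_0_eq_image: "S \<times> {0::real} = (\<lambda>x. (x, 0)) ` S"
  by auto

lemma inj_Pair_0: "inj (\<lambda>x. (x, 0::real))"
  by (rule injI) simp

lemma face_of_Times_0_iff:
  fixes P :: "'a::euclidean_space set"
  shows "F face_of P \<times> {0::real} \<longleftrightarrow> (\<exists>H. H face_of P \<and> F = H \<times> {0})"
  using faces_of_linear_image[OF linear_Pair_0 inj_Pair_0, of P] unfolding Times_0_eq_image by blast

lemma aff_dim_Times_0:
  fixes P :: "'a::euclidean_space set"
  shows "aff_dim (P \<times> {0::real}) = aff_dim P"
  unfolding Times_0_eq_image by (rule aff_dim_injective_linear_image[OF linear_Pair_0 inj_Pair_0])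

lemma polytope_Times_0: "polytope P \<Longrightarrow> polytope (P \<times> {0::real})"
  by (intro polytope_Times polytope_sing)

lemma closed_segment_Times_0:
  fixes u w :: "'a::euclidean_space"
  shows "closed_segment (u, 0) (w, 0) = closed_segment u w \<times> {0::real}"
  unfolding Times_0_eq_image using closed_segment_linear_image[OF linear_Pair_0, of u w] by simp

lemma vertices_of_Times_0:
  fixes P :: "'a::euclidean_space set"
  shows "vertices_of (P \<times> {0::real}) = vertices_of P \<times> {0}"
proof (intro equalityI subsetI)
  fix x assume "x \<in> vertices_of (P \<times> {0::real})"
  then obtain H where H: "H face_of P" "{x} = H \<times> {0}"
    unfolding vertices_of_iff face_of_Times_0_iff by blast
  obtain u t where x: "x = (u, t)" by fastforce
  have "H = fst ` (H \<times> {0::real})" by simp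
  also have "\<dots> = {u}" unfolding H(2)[symmetric] x by simp
  finally have "H = {u}" .
  with H x show "x \<in> vertices_of P \<times> {0}" by (auto simp: vertices_of_iff)
next
  fix x assume "x \<in> vertices_of P \<times> {0::real}"
  then obtain u where "x = (u, 0)" "{u} face_of P" by (auto simp: vertices_of_iff)
  moreover have "{(u, 0::real)} = {u} \<times> {0}" by simp
  ultimately show "x \<in> vertices_of (P \<times> {0})"
    unfolding vertices_of_iff face_of_Times_0_iff by metis
qed

lemma py_eq_pyramid: "py P v = pyramid v (P \<times> {0})"
  by (simp add: py_def pyramid_def)

lemma apex_notin_affine_hull_Times_0:
  assumes "snd v \<noteq> 0"
  shows "v \<notin> affine hull (P \<times> {0::real})"
proof -
  have "affine hull (P \<times> {0::real}) \<subseteq> UNIV \<times> {0}"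
    by (rule hull_minimal) (auto simp: affine_def)
  then show ?thesis using assms by (auto simp: mem_Times_iff)
qed

section \<open>Faces, edges and orientation of the pyramid over \<open>P\<close>\<close>

locale base_and_apex =
  fixes P :: "'a::euclidean_space set" and v :: "'a \<times> real"
  assumes polytope: "polytope P" and apex: "snd v \<noteq> 0"
begin

lemma apex_neq [simp]: "v \<noteq> (u, 0)" "(u, 0) \<noteq> v"
  using apex by auto

lemma polytope_face: "H face_of P \<Longrightarrow> polytope H"
  using polytope face_of_polytope_polytope by blast

lemma face_of_py_iff:
  "F face_of py P v \<longleftrightarrow> (\<exists>H. H face_of P \<and> (F = H \<times> {0} \<or> F = pyramid v (H \<times> {0})))"
  unfolding py_eq_pyramid
    face_of_pyramid_iff[OF polytope_Times_0[OF polytope] apex_notin_affine_hull_Times_0[OF apex]]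
    face_of_Times_0_iff
  by blast

lemma vertices_of_py_face:
  "H face_of P \<Longrightarrow> vertices_of (pyramid v (H \<times> {0})) = insert v (vertices_of H \<times> {0})"
  by (simp add: vertices_of_pyramid polytope_Times_0 polytope_face apex_notin_affine_hull_Times_0 apex
      vertices_of_Times_0)

lemma aff_dim_py_face: "aff_dim (pyramid v (H \<times> {0})) = aff_dim H + 1"
  by (simp add: aff_dim_pyramid apex_notin_affine_hull_Times_0 apex aff_dim_Times_0)

lemma pyramid_point: "pyramid v {(u, 0)} = closed_segment (u, 0) v"
  by (simp add: pyramid_def segment_convex_hull insert_commute)

text \<open>A face of dimension 1 is either an edge of the base or a pyramid over a face of
  dimension 0, that is, over a vertex. A segment determines its endpoints only as an unordered pair,
  whence both orders of \<open>(u, 0)\<close> and \<open>v\<close>.\<close>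

lemma py_edge_iff:
  "closed_segment x y edge_of py P v \<longleftrightarrow>
     (\<exists>u w. x = (u, 0) \<and> y = (w, 0) \<and> closed_segment u w edge_of P) \<or>
     (\<exists>u\<in>vertices_of P. x = (u, 0) \<and> y = v \<or> x = v \<and> y = (u, 0))" (is "?l \<longleftrightarrow> ?r")
proof
  assume ?l
  then have "closed_segment x y face_of py P v" and dim: "aff_dim (closed_segment x y) = 1"
    by (simp_all add: edge_of_def)
  then obtain H where H: "H face_of P"
    "closed_segment x y = H \<times> {0} \<or> closed_segment x y = pyramid v (H \<times> {0})"
    unfolding face_of_py_iff by blast
  from H(2) show ?r
  proof
    assume eq: "closed_segment x y = H \<times> {0}"
    have "x \<in> H \<times> {0}" "y \<in> H \<times> {0}" unfolding eq[symmetric] by simp_all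
    then obtain u w where xy: "x = (u, 0)" "y = (w, 0)" by (auto simp: mem_Times_iff prod_eq_iff)
    have "closed_segment u w \<times> {0::real} = H \<times> {0}" using eq unfolding xy closed_segment_Times_0 .
    then have "closed_segment u w = H" by (simp add: times_eq_iff)
    moreover have "aff_dim H = 1" using dim unfolding eq aff_dim_Times_0 .
    ultimately show ?r using H(1) xy by (auto simp: edge_of_def)
  next
    assume eq: "closed_segment x y = pyramid v (H \<times> {0})"
    have "aff_dim H = 0" using dim unfolding eq aff_dim_py_face by simp
    then obtain u where u: "H = {u}" by (auto simp: aff_dim_eq_0)
    have "{u} \<times> {0::real} = {(u, 0)}" by simp
    then have "closed_segment x y = closed_segment (u, 0) v"
      using eq unfolding u by (simp add: pyramid_point)
    then have "{x, y} = {(u, 0), v}" by (simp only: closed_segment_eq)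
    moreover have "u \<in> vertices_of P" using H(1) u by (simp add: vertices_of_iff)
    ultimately show ?r by (auto simp: doubleton_eq_iff)
  qed
next
  assume ?r
  then show ?l
  proof (elim disjE exE bexE conjE)
    fix u w assume "x = (u, 0)" "y = (w, 0)" "closed_segment u w edge_of P"
    then show ?l
      unfolding edge_of_def face_of_py_iff by (auto simp: closed_segment_Times_0 aff_dim_Times_0)
  next
    fix u assume u: "u \<in> vertices_of P"
    have "pyramid v ({u} \<times> {0}) face_of py P v" "aff_dim (pyramid v ({u} \<times> {0})) = 1"
      using u aff_dim_py_face[of "{u}"] unfolding face_of_py_iff by (auto simp: vertices_of_iff)
    then have "closed_segment (u, 0) v edge_of py P v"
      by (simp add: edge_of_def pyramid_point)
    then show "x = (u, 0) \<Longrightarrow> y = v \<Longrightarrow> ?l" "x = v \<Longrightarrow> y = (u, 0) \<Longrightarrow> ?l"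
      by (simp_all add: closed_segment_commute)
  qed
qed

lemma py_digraph_iff [simp]:
  "((u, 0), (w, 0)) \<in> py_digraph P E v \<longleftrightarrow> (u, w) \<in> E"
  "((u, 0), v) \<in> py_digraph P E v \<longleftrightarrow> u \<in> vertices_of P"
  "(v, y) \<notin> py_digraph P E v"
  by (auto simp: py_digraph_def)

lemma py_digraphE:
  assumes "(x, y) \<in> py_digraph P E v"
  obtains (base) u w where "x = (u, 0)" "y = (w, 0)" "(u, w) \<in> E"
    | (apex) u where "x = (u, 0)" "y = v" "u \<in> vertices_of P"
  using assms by (auto simp: py_digraph_def)

lemma polytopal_digraph_py:
  assumes "polytopal_digraph P E"
  shows "polytopal_digraph (py P v) (py_digraph P E v)"
  unfolding polytopal_digraph_def
proof (intro conjI allI impI)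
  show "polytope (py P v)"
    unfolding py_eq_pyramid by (intro polytope_pyramid polytope_Times_0 polytope)
  have E: "(u, w) \<in> E \<Longrightarrow> closed_segment u w edge_of P"
    "closed_segment u w edge_of P \<Longrightarrow> ((u, w) \<in> E) \<noteq> ((w, u) \<in> E)" for u w
    using assms by (simp_all add: polytopal_digraph_def)
  show "closed_segment x y edge_of py P v" if "(x, y) \<in> py_digraph P E v" for x y
    using that by (cases rule: py_digraphE) (auto simp: py_edge_iff E(1))
  show "((x, y) \<in> py_digraph P E v) \<noteq> ((y, x) \<in> py_digraph P E v)"
    if "closed_segment x y edge_of py P v" for x y
    using that unfolding py_edge_iff by (elim disjE exE bexE conjE) (simp_all add: E(2))
qed

text \<open>No edge leaves \<open>v\<close>, so a walk that reaches it ends there, and a walk that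
  does not is a walk in \<open>E\<close>.\<close>

lemma acyclic_py:
  assumes "acyclic E"
  shows "acyclic (py_digraph P E v)"
proof -
  have "\<exists>u. x = (u, 0) \<and> (y = v \<or> (\<exists>w. y = (w, 0) \<and> (u, w) \<in> E\<^sup>+))"
    if "(x, y) \<in> (py_digraph P E v)\<^sup>+" for x y
    using that
  proof (induction rule: trancl_induct)
    case (base y)
    then show ?case by (cases rule: py_digraphE) auto
  next
    case (step y z)
    from step.hyps(2) show ?case
    proof (cases rule: py_digraphE)
      case (base u w)
      then show ?thesis using step.IH by (auto intro: trancl_into_trancl)
    next
      case (apex u)
      then show ?thesis using step.IH by auto
    qed
  qed
  then have "(x, x) \<notin> (py_digraph P E v)\<^sup>+" for x
    using assms unfolding acyclic_def by fastforce
  then show ?thesis by (simp add: acyclic_def)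
qed

section \<open>Sources and sinks in the faces of the pyramid\<close>

lemma induced_base:
  "induced_digraph (py_digraph P E v) (H \<times> {0}) = {((u, 0), (w, 0)) | u w. (u, w) \<in> induced_digraph E H}"
  unfolding induced_digraph_def vertices_of_Times_0
  by (auto simp: mem_Times_iff elim!: py_digraphE)

lemma induced_py:
  assumes "H face_of P"
  shows "induced_digraph (py_digraph P E v) (pyramid v (H \<times> {0})) =
    {((u, 0), (w, 0)) | u w. (u, w) \<in> induced_digraph E H} \<union> {((u, 0), v) | u. u \<in> vertices_of H}"
  unfolding induced_digraph_def vertices_of_py_face[OF assms]
  using vertices_of_face[OF assms] by (auto simp: py_digraph_def)

lemma source_in_base:
  "source_in (py_digraph P E v) (H \<times> {0}) x \<longleftrightarrow> (\<exists>s. x = (s, 0) \<and> source_in E H s)"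
  unfolding source_in_def induced_base vertices_of_Times_0 by auto

lemma sink_in_base:
  "sink_in (py_digraph P E v) (H \<times> {0}) x \<longleftrightarrow> (\<exists>s. x = (s, 0) \<and> sink_in E H s)"
  unfolding sink_in_def induced_base vertices_of_Times_0 by auto

text \<open>Any vertex of a non-empty \<open>H\<close> sends an edge to \<open>v\<close>, so
  \<open>v\<close> is not a source. Over the empty face the pyramid is \<open>{v}\<close>, where
  \<open>v\<close> is both source and sink.\<close>

lemma source_in_py:
  assumes "H face_of P"
  shows "source_in (py_digraph P E v) (pyramid v (H \<times> {0})) x \<longleftrightarrow>
    (if H = {} then x = v else \<exists>s. x = (s, 0) \<and> source_in E H s)"
proof (cases "H = {}")
  case True
  then have "vertices_of H = {}" using vertices_of_subset by blast
  then show ?thesis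
    using True unfolding source_in_def induced_py[OF assms] vertices_of_py_face[OF assms]
    by (auto simp: induced_digraph_def)
next
  case False
  then obtain w where "w \<in> vertices_of H"
    using polytope_face[OF assms] polytope_vertex_exists by blast
  then show ?thesis
    using False unfolding source_in_def induced_py[OF assms] vertices_of_py_face[OF assms] by auto
qed

lemma sink_in_py:
  assumes "H face_of P"
  shows "sink_in (py_digraph P E v) (pyramid v (H \<times> {0})) x \<longleftrightarrow> x = v"
proof
  assume sink: "sink_in (py_digraph P E v) (pyramid v (H \<times> {0})) x"
  show "x = v"
  proof (rule ccontr)
    assume "x \<noteq> v"
    then obtain u where "x = (u, 0)" "u \<in> vertices_of H"
      using sink unfolding sink_in_def vertices_of_py_face[OF assms] by auto
    then have "(x, v) \<in> induced_digraph (py_digraph P E v) (pyramid v (H \<times> {0}))"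
      unfolding induced_py[OF assms] by blast
    then show False using sink unfolding sink_in_def by blast
  qed
qed (auto simp: sink_in_def induced_py[OF assms] vertices_of_py_face[OF assms])

section \<open>Unique sinks and the Holt-Klee property\<close>

lemma unique_sink_orientation_py:
  assumes "unique_sink_orientation P E"
  shows "unique_sink_orientation (py P v) (py_digraph P E v)"
  unfolding unique_sink_orientation_def
proof (intro allI impI, elim conjE)
  fix F assume F: "F face_of py P v" "F \<noteq> {}"
  then obtain H where H: "H face_of P" "F = H \<times> {0} \<or> F = pyramid v (H \<times> {0})"
    unfolding face_of_py_iff by blast
  have uso: "\<exists>!s. source_in E H s" "\<exists>!t. sink_in E H t" if "H \<noteq> {}"
    using assms H(1) that unfolding unique_sink_orientation_def by blast+
  from H(2) show "(\<exists>!s. source_in (py_digraph P E v) F s) \<and> (\<exists>!t. sink_in (py_digraph P E v) F t)"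
  proof
    assume eq: "F = H \<times> {0}"
    then have "H \<noteq> {}" using F by auto
    then show ?thesis using uso unfolding eq source_in_base sink_in_base by auto
  next
    assume eq: "F = pyramid v (H \<times> {0})"
    show ?thesis
      using uso(1) unfolding eq source_in_py[OF H(1)] sink_in_py[OF H(1)] by (cases "H = {}") auto
  qed
qed

text \<open>Excludes a degenerate path system: for \<open>s = t\<close> the list \<open>[s]\<close>
  is a \<open>dipath\<close>, and on an edge, where one path is required, it would suffice. But an
  edge is oriented one way or the other, so neither endpoint is both source and sink.\<close>

lemma source_neq_sink_edge:
  assumes "polytopal_digraph P E" "H edge_of P" "source_in E H s" "sink_in E H t"
  shows "s \<noteq> t"
proof
  assume "s = t"
  have H: "H face_of P" "aff_dim H = 1" using assms(2) by (simp_all add: edge_of_def)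
  have "H \<noteq> {}" using H(2) by auto
  moreover have "compact H" "convex H"
    using polytope_face[OF H(1)] polytope_imp_compact polytope_imp_convex by blast+
  moreover have "collinear H" using H(2) by (simp add: collinear_aff_dim)
  ultimately obtain a b where ab: "H = closed_segment a b" by (rule compact_convex_collinear_segment)
  have verts: "vertices_of H = {a, b}"
    unfolding ab vertices_of_def by (auto simp: extreme_point_of_segment)
  have "(a, b) \<in> E \<or> (b, a) \<in> E"
    using assms(1,2) unfolding ab polytopal_digraph_def by blast
  then have "(a, b) \<in> induced_digraph E H \<or> (b, a) \<in> induced_digraph E H"
    by (auto simp: induced_digraph_def verts)
  moreover have "s = a \<or> s = b" using assms(3) by (simp add: source_in_def verts)
  ultimately show False
    using assms(3,4) unfolding source_in_def sink_in_def \<open>s = t\<close> by blast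
qed

lemma holt_klee_py:
  assumes dg: "polytopal_digraph P E" and hk: "holt_klee P E"
  shows "holt_klee (py P v) (py_digraph P E v)"
proof -
  have uso_P: "unique_sink_orientation P E" using hk by (simp add: holt_klee_def)
  let ?i = "\<lambda>u. (u, 0::real)"
  have main: "\<exists>Ps. finite Ps \<and> int (card Ps) = aff_dim F \<and>
      (\<forall>p\<in>Ps. dipath (induced_digraph (py_digraph P E v) F) x p y) \<and>
      (\<forall>p\<in>Ps. \<forall>q\<in>Ps. p \<noteq> q \<longrightarrow> set p \<inter> set q \<subseteq> {x, y})"
    if F: "F face_of py P v" "F \<noteq> {}" and x: "source_in (py_digraph P E v) F x"
      and y: "sink_in (py_digraph P E v) F y" for F x y
  proof -
    let ?G = "induced_digraph (py_digraph P E v) F"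
    obtain H where H: "H face_of P" "F = H \<times> {0} \<or> F = pyramid v (H \<times> {0})"
      using F(1) unfolding face_of_py_iff by blast
    have uso: "\<exists>!s. source_in E H s" "\<exists>!t. sink_in E H t" if "H \<noteq> {}"
      using uso_P H(1) that unfolding unique_sink_orientation_def by blast+
    have paths: "\<exists>Ps. finite Ps \<and> int (card Ps) = aff_dim H \<and> (\<forall>p\<in>Ps. dipath (induced_digraph E H) s p t) \<and>
        (\<forall>p\<in>Ps. \<forall>q\<in>Ps. p \<noteq> q \<longrightarrow> set p \<inter> set q \<subseteq> {s, t})"
      if "H \<noteq> {}" "source_in E H s" "sink_in E H t" for s t
      using hk[unfolded holt_klee_def, THEN conjunct2, rule_format, of H s t] H(1) that by simp
    have inj_map: "inj (map ?i)" by (simp add: inj_Pair_0 inj_mapI)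
    show ?thesis
      using H(2)
    proof
      assume eq: "F = H \<times> {0}"
      then have "H \<noteq> {}" using F by auto
      obtain s t where st: "x = (s, 0)" "source_in E H s" "y = (t, 0)" "sink_in E H t"
        using x y unfolding eq source_in_base sink_in_base by blast
      obtain Ps where Ps: "finite Ps" "int (card Ps) = aff_dim H"
        "\<forall>p\<in>Ps. dipath (induced_digraph E H) s p t"
        "\<forall>p\<in>Ps. \<forall>q\<in>Ps. p \<noteq> q \<longrightarrow> set p \<inter> set q \<subseteq> {s, t}"
        using paths[OF \<open>H \<noteq> {}\<close> st(2,4)] by (elim exE conjE) (rule that)
      note Ps = Ps(1,2) Ps(3)[rule_format] Ps(4)[rule_format]
      have "card (map ?i ` Ps) = card Ps" by (intro card_image inj_on_subset[OF inj_map]) simp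
      moreover have "dipath ?G x (map ?i p) y" if "p \<in> Ps" for p
        unfolding eq induced_base st(1,3) using Ps(3)[OF that] inj_Pair_0 by (rule dipath_map) blast
      moreover have "\<forall>p\<in>map ?i ` Ps. \<forall>q\<in>map ?i ` Ps. p \<noteq> q \<longrightarrow> set p \<inter> set q \<subseteq> {x, y}"
      proof (intro ballI impI)
        fix p q assume pq: "p \<in> map ?i ` Ps" "q \<in> map ?i ` Ps" "p \<noteq> q"
        then obtain p' q' where "p = map ?i p'" "q = map ?i q'" "p' \<in> Ps" "q' \<in> Ps" by blast
        then show "set p \<inter> set q \<subseteq> {x, y}" using Ps(4)[of p' q'] pq(3) unfolding st(1,3) by auto
      qed
      moreover have "aff_dim F = aff_dim H" unfolding eq by (rule aff_dim_Times_0)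
      ultimately show ?thesis
        using Ps(1,2) by (intro exI[of _ "map ?i ` Ps"] conjI) (simp_all add: ball_simps)
    next
      assume eq: "F = pyramid v (H \<times> {0})"
      have [simp]: "y = v" using y unfolding eq sink_in_py[OF H(1)] .
      show ?thesis
      proof (cases "H = {}")
        \<comment> \<open>The face is \<open>{v}\<close>, of dimension 0, and no path is
          required.\<close>
        case True
        then show ?thesis by (intro exI[of _ "{}"]) (simp add: eq)
      next
        case False
        obtain s where s: "x = (s, 0)" "source_in E H s"
          using x False unfolding eq source_in_py[OF H(1)] by auto
        obtain t where t: "sink_in E H t" using uso(2)[OF False] by blast
        obtain Ps where Ps: "finite Ps" "int (card Ps) = aff_dim H"
          "\<forall>p\<in>Ps. dipath (induced_digraph E H) s p t"
          "\<forall>p\<in>Ps. \<forall>q\<in>Ps. p \<noteq> q \<longrightarrow> set p \<inter> set q \<subseteq> {s, t}"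
          using paths[OF False s(2) t] by (elim exE conjE) (rule that)
        note Ps = Ps(1,2) Ps(3)[rule_format] Ps(4)[rule_format]
        have sH: "s \<in> vertices_of H" using s(2) by (simp add: source_in_def)
        \<comment> \<open>For \<open>s = t\<close>, distinctness of the vertices on a path leaves
          only \<open>[s]\<close>. The number of paths, and hence the dimension of \<open>H\<close>,
          is then 1, and \<open>H\<close> is an edge.\<close>
        have st: "s \<noteq> t" if "Ps \<noteq> {}"
        proof
          assume "s = t"
          have "p = [s]" if "p \<in> Ps" for p
          proof (cases p)
            case (Cons z zs)
            then have "z = s" "distinct (s # zs)" "last p = s"
              using Ps(3)[OF that] \<open>s = t\<close> by (auto simp: dipath_def)
            then have "zs = []" using Cons last_in_set[of zs] by (auto split: if_splits)
            with Cons \<open>z = s\<close> show ?thesis by simp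
          qed (use Ps(3)[OF that] in \<open>simp add: dipath_def\<close>)
          then have "Ps = {[s]}" using that by blast
          then have "H edge_of P" using Ps(2) H(1) by (simp add: edge_of_def)
          then show False using source_neq_sink_edge[OF dg _ s(2) t] \<open>s = t\<close> by blast
        qed
        have ind: "?G = {((u, 0), (w, 0)) | u w. (u, w) \<in> induced_digraph E H} \<union> {((u, 0), v) | u. u \<in> vertices_of H}"
          unfolding eq by (rule induced_py[OF H(1)])
        have "\<exists>Qs. finite Qs \<and> card Qs = Suc (card (map ?i ` Ps)) \<and> (\<forall>p\<in>Qs. dipath ?G (s, 0) p v) \<and>
            (\<forall>p\<in>Qs. \<forall>q\<in>Qs. p \<noteq> q \<longrightarrow> set p \<inter> set q \<subseteq> {(s, 0), v})"
        proof (rule dipaths_to_apex[where t = "(t, 0)"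
              and A = "{((u, 0), (w, 0)) | u w. (u, w) \<in> induced_digraph E H}"])
          show "finite (map ?i ` Ps)" using Ps(1) by simp
          show "dipath {((u, 0), (w, 0)) | u w. (u, w) \<in> induced_digraph E H} (s, 0) p (t, 0)"
            if "p \<in> map ?i ` Ps" for p
            using that by (elim imageE, hypsubst) (rule dipath_map[OF Ps(3) inj_Pair_0], auto)
          show "set p \<inter> set q \<subseteq> {(s, 0), (t, 0)}"
            if pq: "p \<in> map ?i ` Ps" "q \<in> map ?i ` Ps" "p \<noteq> q" for p q
          proof -
            obtain p' q' where "p = map ?i p'" "q = map ?i q'" "p' \<in> Ps" "q' \<in> Ps" using pq by blast
            then show ?thesis using Ps(4)[of p' q'] pq(3) by auto
          qed
          show "(s, 0) \<noteq> (t, 0::real)" if "map ?i ` Ps \<noteq> {}" using that st by simp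
          show "(z, v) \<in> ?G" if "p \<in> map ?i ` Ps" "z \<in> set p" for p z
          proof -
            obtain p' where "p = map ?i p'" "p' \<in> Ps" using \<open>p \<in> _\<close> by blast
            then show ?thesis
              using dipath_vertices[OF Ps(3) sH, of p'] \<open>z \<in> set p\<close> unfolding ind by auto
          qed
          show "((s, 0), v) \<in> ?G" unfolding ind using sH by blast
        qed (auto simp: ind)
        moreover have "card (map ?i ` Ps) = card Ps" by (intro card_image inj_on_subset[OF inj_map]) simp
        moreover have "aff_dim F = int (Suc (card Ps))" unfolding eq aff_dim_py_face Ps(2)[symmetric] by simp
        ultimately show ?thesis unfolding s(1) by auto
      qed
    qed
  qed
  then show ?thesis
    unfolding holt_klee_def using unique_sink_orientation_py[OF uso_P] by simp
qed

section \<open>Transfer of the shelling property\<close>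

lemma topological_sort_pyE:
  assumes "topological_sort (py P v) (py_digraph P E v) ws"
  obtains us where "ws = map (\<lambda>u. (u, 0)) us @ [v]" "topological_sort P E us"
proof -
  have dist: "distinct ws"
    and sorted: "\<And>i j. i < length ws \<Longrightarrow> j < length ws \<Longrightarrow> (ws ! i, ws ! j) \<in> py_digraph P E v \<Longrightarrow> i < j"
    using assms by (simp_all add: topological_sort_def)
  have set: "set ws = insert v (vertices_of P \<times> {0})"
    using assms vertices_of_py_face[OF face_of_refl[OF polytope_imp_convex[OF polytope]]]
    by (simp add: topological_sort_def py_eq_pyramid)
  then have "ws \<noteq> []" by auto
  have "last ws = v"
  proof (rule ccontr)
    assume ne: "last ws \<noteq> v"
    have "last ws \<in> set ws" using \<open>ws \<noteq> []\<close> by simp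
    then obtain u where u: "last ws = (u, 0)" "u \<in> vertices_of P" using ne set by auto
    have "v \<in> set ws" using set by simp
    then obtain j where j: "j < length ws" "ws ! j = v" by (metis in_set_conv_nth)
    \<comment> \<open>Were a base vertex last, its edge to \<open>v\<close> would force
      \<open>v\<close> to come even later.\<close>
    have "(ws ! (length ws - 1), ws ! j) \<in> py_digraph P E v"
      using u(2) unfolding j(2) last_conv_nth[OF \<open>ws \<noteq> []\<close>, symmetric] u(1) by simp
    then have "length ws - 1 < j" by (rule sorted[rotated 2]) (use \<open>ws \<noteq> []\<close> j in simp_all)
    with j show False by simp
  qed
  define bs where "bs = butlast ws"
  have ws: "ws = bs @ [v]"
    using append_butlast_last_id[OF \<open>ws \<noteq> []\<close>] \<open>last ws = v\<close> by (simp add: bs_def)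
  have set_bs: "set bs = vertices_of P \<times> {0}"
  proof (rule insert_ident[THEN iffD1])
    show "insert v (set bs) = insert v (vertices_of P \<times> {0})" using set unfolding ws by simp
    show "v \<notin> set bs" using dist unfolding ws by simp
  qed auto
  define us where "us = map fst bs"
  have bs: "bs = map (\<lambda>u. (u, 0)) us"
    unfolding us_def map_map comp_def
  proof (rule sym, rule map_idI)
    fix x assume "x \<in> set bs"
    then show "(fst x, 0) = x" unfolding set_bs by auto
  qed
  have "topological_sort P E us"
    unfolding topological_sort_def
  proof (intro conjI allI impI)
    show "distinct us" using dist unfolding ws us_def using bs by (metis distinct_append distinct_map us_def)
    show "set us = vertices_of P" unfolding us_def set_map set_bs by simp
    fix i j assume "i < length us" "j < length us" "(us ! i, us ! j) \<in> E"
    then show "i < j" using sorted[of i j] unfolding ws bs by (simp add: nth_append)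
  qed
  moreover have "ws = map (\<lambda>u. (u, 0)) us @ [v]" using ws unfolding bs .
  ultimately show ?thesis by (intro that)
qed

lemma shelling_property_base:
  assumes dim: "1 \<le> aff_dim P" and sp: "shelling_property (py P v) (py_digraph P E v)"
  shows "shelling_property P E"
proof -
  let ?B = "P \<times> {0::real}"
  obtain ws Q \<phi> where ts: "topological_sort (py P v) (py_digraph P E v) ws"
    and polar: "combinatorial_polar (py P v) Q \<phi>" and sh: "shelling Q (map (\<lambda>w. \<phi> {w}) ws)"
    using sp by (auto simp: shelling_property_def)
  obtain us where ws: "ws = map (\<lambda>u. (u, 0)) us @ [v]" and us: "topological_sort P E us"
    using ts by (rule topological_sort_pyE)
  have facet: "\<phi> {v} facet_of Q"
    using shelling_facets[OF sh] by (auto simp: ws)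
  interpret pp: pyramid_polar v ?B Q \<phi>
    using polytope_Times_0[OF polytope] apex_notin_affine_hull_Times_0[OF apex] polar facet
    by unfold_locales (simp_all add: py_eq_pyramid)
  \<comment> \<open>The ambient space of \<open>Q\<close> has one dimension more than
    \<open>'a\<close>, and a facet loses one, so the facet fits into \<open>'a\<close>.\<close>
  have "aff_dim Q \<le> DIM('a \<times> real)" by (rule aff_dim_le_DIM)
  then have "aff_dim (\<phi> {v}) \<le> DIM('a)" using facet by (simp add: facet_of_def)
  then obtain c and g :: "'a \<Rightarrow> 'a \<times> real" where g: "linear g" "inj g" "\<phi> {v} \<subseteq> range (\<lambda>y. c + g y)"
    by (rule affine_embedding_onto_hyperplane)
  let ?h = "\<lambda>y. c + g y"
  \<comment> \<open>The polarity of \<open>P\<close>: a face goes to the pyramid over it, then by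
    \<open>\<phi>\<close> to a face of the facet \<open>\<phi> {v}\<close>, and finally back into
    \<open>'a\<close>.\<close>
  define \<psi> where "\<psi> H = ?h -` \<phi> (pyramid v (H \<times> {0}))" for H
  have "set us = vertices_of P" using us by (simp add: topological_sort_def)
  then have "shelling (\<phi> {v}) (map (\<lambda>w. \<phi> (pyramid v {w})) (map (\<lambda>u. (u, 0)) us))"
    using sh dim unfolding ws
    by (intro pp.shelling_facet) (auto simp: vertices_of_Times_0 aff_dim_Times_0)
  then have "shelling (?h -` \<phi> {v}) (map (vimage ?h) (map (\<lambda>w. \<phi> (pyramid v {w})) (map (\<lambda>u. (u, 0)) us)))"
    using g(3) by (rule shelling_vimage[OF g(1,2)])
  moreover have "map (vimage ?h) (map (\<lambda>w. \<phi> (pyramid v {w})) (map (\<lambda>u. (u, 0)) us)) = map (\<lambda>u. \<psi> {u}) us"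
    by (simp add: \<psi>_def)
  ultimately have "shelling (?h -` \<phi> {v}) (map (\<lambda>u. \<psi> {u}) us)" by (simp only:)
  moreover have "combinatorial_polar P (?h -` \<phi> {v}) \<psi>"
    unfolding combinatorial_polar_def
  proof (intro conjI allI impI)
    show "polytope (?h -` \<phi> {v})"
      using g pp.polytope_facet by (rule polytope_vimage)
    have "bij_betw (\<lambda>H. H \<times> {0::real}) {H. H face_of P} {F. F face_of ?B}"
      by (auto simp: bij_betw_def inj_on_def face_of_Times_0_iff times_eq_iff)
    from bij_betw_trans[OF bij_betw_trans[OF this pp.bij_betw_facet] bij_betw_vimage_faces[OF g]]
    show "bij_betw \<psi> {F. F face_of P} {F. F face_of ?h -` \<phi> {v}}"
      unfolding comp_def \<psi>_def[symmetric] .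
    fix F G assume "F face_of P \<and> G face_of P"
    then have FG: "F \<times> {0} face_of ?B" "G \<times> {0} face_of ?B"
      by (auto simp: face_of_Times_0_iff)
    let ?F = "pyramid v (F \<times> {0})" and ?G = "pyramid v (G \<times> {0})"
    \<comment> \<open>Preimages preserve inclusions always, but reflect them only if the smaller set
      lies in the range.\<close>
    have "\<phi> ?G \<subseteq> range ?h"
      using bij_betw_apply[OF pp.bij_betw_facet, of "G \<times> {0}"] FG(2) g(3) face_of_imp_subset[of "\<phi> ?G" "\<phi> {v}"] by auto
    then have "\<psi> G \<subseteq> \<psi> F \<longleftrightarrow> \<phi> ?G \<subseteq> \<phi> ?F"
      unfolding \<psi>_def by blast
    also have "\<dots> \<longleftrightarrow> ?F \<subseteq> ?G"
      using FG by (intro pp.polar_le_iff pp.pyramid_face)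
    also have "\<dots> \<longleftrightarrow> F \<times> {0::real} \<subseteq> G \<times> {0}"
      by (rule face_of_pyramid_mono_iff[OF pp.B pp.a FG])
    also have "\<dots> \<longleftrightarrow> F \<subseteq> G" by auto
    finally show "F \<subseteq> G \<longleftrightarrow> \<psi> G \<subseteq> \<psi> F" ..
  qed
  ultimately show ?thesis using us by (auto simp: shelling_property_def)
qed

end

theorem theorem5:
  fixes P :: "'a::euclidean_space set"
    and E :: "('a \<times> 'a) set"
    and v :: "'a \<times> real"
  assumes "polytope P"
    and "aff_dim P = int DIM('a)"
    and "v \<notin> UNIV \<times> {0}"
    and "X_type P E"
  shows "X_type (py P v) (py_digraph P E v)"
proof -
  interpret base_and_apex P v
    using assms(1,3) by unfold_locales (auto simp: mem_Times_iff)
  \<comment> \<open>Every type of class \<open>euclidean_space\<close> has positive dimension, so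
    \<open>P\<close> is not a point and its pyramid not a mere segment.\<close>
  have "1 \<le> aff_dim P" using assms(2) DIM_positive[where 'a = 'a] by linarith
  moreover have "polytopal_digraph P E" "acyclic E" "unique_sink_orientation P E" "holt_klee P E"
    and "\<not> shelling_property P E"
    using assms(4) by (simp_all add: X_type_def)
  ultimately show ?thesis
    unfolding X_type_def
    by (intro conjI notI polytopal_digraph_py acyclic_py unique_sink_orientation_py holt_klee_py)
      (use shelling_property_base in blast)+
qed

end
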